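(* Let $\mathrm{T}>0$. For every $t \in [0,\mathrm{T})$ and every $u_0\in C^\infty_b(\mathbb{R})$, with $\kappa = \max ( \| u_0 \|_{\infty},1)$, we have $$\left\| T^tu_0 - X^t Y^t u_0 \right\|_{\infty} \leq \frac{t^2 \exp \left( 2t \|f'\|_{[-\kappa,\kappa]} \right) \|f''\|_{[-\kappa,\kappa]} }{2} \left\| \partial_x u_0 \right\|^2_{\infty},$$ and $$\left\| T^tu_0 - Y^t X^t u_0 \right\|_{\infty} \leq \frac{t^2 \exp \left( 2t \|f'\|_{[-\kappa,\kappa]} \right) \|f''\|_{[-\kappa,\kappa]} }{2} \left\| \partial_x u_0 \right\|^2_{\infty}.$$
   Context: $C^\infty_b(\mathbb{R})$ denotes the space of functions of class $C^\infty$ on $\mathbb{R}$ that are bounded over $\mathbb{R}$, with the maximum norm $\|\cdot\|_\infty$. The function $f:\mathbb{R}\to\mathbb{R}$ is of class $C^\infty$ with $f(0)=0$ and satisfies: $|r|\ge 1 \Rightarrow r f(r)\le 0$. For a continuous scalar function $g$ and real $a$, $\|g\|_{[-a,a]}=\sup_{r\in[-a,a]}|g(r)|$. For initial data in $C^\infty_b(\mathbb{R})$ and $t\ge 0$ define three (bounded-solution) semi-flows: - $T^tu_0$ is the solution $u(\cdot,t)$ of $\partial_t u-\partial_x^2 u=f(u)$ on $\mathbb{R}\times(0,\infty)$, $u(\cdot,0)=u_0$; - $X^tv_0$ is the solution $v(\cdot,t)$ of the heat equation $\partial_t v-\partial_x^2 v=0$, $v(\cdot,0)=v_0$ (given by the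 heat semi-group, i.e. Gauss–Weierstrass convolution); - $Y^tw_0$ is the solution $w(\cdot,t)$ of $\partial_t w=f(w)$ (pointwise in $x$), $w(\cdot,0)=w_0$. Compositions are read as $X^tY^tu_0=X^t(Y^tu_0)$. *)

theory Defs
  imports "HOL-Analysis.Analysis"
begin

definition smooth :: "(real \<Rightarrow> real) \<Rightarrow> bool" where
  "smooth g \<longleftrightarrow> (\<forall>k x. (deriv ^^ k) g differentiable (at x))"

text \<open>Only the function itself is required to be bounded, not its derivatives.\<close>

definition Cb_infinity :: "(real \<Rightarrow> real) set" where
  "Cb_infinity = {g. smooth g \<and> bounded (range g)}"

text \<open>
  Real-valued, hence meaningful only for \<open>g\<close> bounded on the nonempty set \<open>A\<close>.
\<close>

definition sup_norm_on :: "real set \<Rightarrow> (real \<Rightarrow> real) \<Rightarrow> real" where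
  "sup_norm_on A g = (SUP r\<in>A. \<bar>g r\<bar>)"

text \<open>
  The supremum norm over the real line with values in \<open>[0, \<infinity>]\<close>, for functions such as
  the derivative of an element of \<^const>\<open>Cb_infinity\<close>, which may be unbounded.
  A product with a zero factor is \<open>0\<close> in \<^typ>\<open>ennreal\<close>, also when the other factor is \<open>\<infinity>\<close>.
\<close>

definition sup_norm :: "(real \<Rightarrow> real) \<Rightarrow> ennreal" where
  "sup_norm g = (SUP x. ennreal \<bar>g x\<bar>)"

text \<open>
  \<open>u t x\<close> is a classical solution of \<open>u\<^sub>t - u\<^sub>x\<^sub>x = f(u)\<close> for \<open>t > 0\<close>, continuous up to
  \<open>t = 0\<close> and bounded on every strip \<open>[0, S] \<times> \<real>\<close>; boundedness is what makes
  the solution with given initial datum unique.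
\<close>

definition reaction_diffusion_solution ::
    "(real \<Rightarrow> real) \<Rightarrow> (real \<Rightarrow> real) \<Rightarrow> (real \<Rightarrow> real \<Rightarrow> real) \<Rightarrow> bool" where
  "reaction_diffusion_solution f u0 u \<longleftrightarrow>
     u 0 = u0 \<and>
     continuous_on ({0..} \<times> UNIV) (\<lambda>(t, x). u t x) \<and>
     (\<forall>S. bounded ((\<lambda>(t, x). u t x) ` ({0..S} \<times> UNIV))) \<and>
     (\<forall>t>0. \<forall>x.
        (\<lambda>s. u s x) differentiable (at t) \<and>
        u t differentiable (at x) \<and>
        deriv (u t) differentiable (at x) \<and>
        deriv (\<lambda>s. u s x) t - deriv (deriv (u t)) x = f (u t x))"

definition heat_flow :: "real \<Rightarrow> (real \<Rightarrow> real) \<Rightarrow> real \<Rightarrow> real" where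
  "heat_flow t v0 x =
     (if t = 0 then v0 x
      else (LINT y|lborel. exp (- (x - y)\<^sup>2 / (4 * t)) / sqrt (4 * pi * t) * v0 y))"

definition reaction_solution :: "(real \<Rightarrow> real) \<Rightarrow> real \<Rightarrow> (real \<Rightarrow> real) \<Rightarrow> bool" where
  "reaction_solution f r w \<longleftrightarrow>
     w 0 = r \<and>
     (\<forall>t\<ge>0. (w has_real_derivative f (w t)) (at t within {0..}))"

text \<open>
  For locally Lipschitz \<open>f\<close> with \<open>r * f r \<le> 0\<close> outside a bounded interval, the solution
  exists on \<open>[0, \<infinity>)\<close> and is unique, so the description below is proper for \<open>t \<ge> 0\<close>.
\<close>

definition reaction_flow ::
    "(real \<Rightarrow> real) \<Rightarrow> real \<Rightarrow> (real \<Rightarrow> real) \<Rightarrow> real \<Rightarrow> real" where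
  "reaction_flow f t w0 x = (THE y. \<exists>w. reaction_solution f (w0 x) w \<and> y = w t)"

end

theory Submission
  imports Defs "HOL-Probability.Distributions"
begin

text \<open>
  Write \<open>\<phi>(s, r)\<close> for the reaction flow, \<open>L\<close> and \<open>M\<close> for the maxima of \<open>\<bar>f'\<bar>\<close> and \<open>\<bar>f''\<bar>\<close> on
  \<open>[-\<kappa>, \<kappa>]\<close>, and \<open>D\<close> for the supremum of \<open>\<bar>\<partial>\<^sub>x u0\<bar>\<close>.  The idea is to let the times of both factors of a
  composition run together: each of \<open>w(s) = X\<^sup>s Y\<^sup>s u0\<close> and \<open>w(s) = Y\<^sup>s X\<^sup>s u0\<close> then solves the
  reaction-diffusion equation up to a residual \<open>w\<^sub>s - w\<^sub>x\<^sub>x - f(w)\<close>, and both residuals are bounded by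
  \<open>s e\<^bsup>2sL\<^esup> M D\<^sup>2\<close>.

  For \<open>w = X\<^sup>s Y\<^sup>s u0\<close> the residual is \<open>X\<^sup>s f(Y\<^sup>s u0) - f(X\<^sup>s Y\<^sup>s u0)\<close>.  As \<open>X\<^sup>s\<close> averages against a
  Gaussian of variance \<open>2s\<close>, this is the gap in Jensen's inequality, which Taylor's formula bounds by
  \<open>M/2\<close> times the variance of \<open>Y\<^sup>s u0\<close> under that Gaussian, hence by \<open>M/2 \<cdot> 2s (e\<^bsup>sL\<^esup> D)\<^sup>2\<close>
  (\<open>heat_flow_reaction_commutator\<close>).  For \<open>w = \<phi>(s, v)\<close> with \<open>v = X\<^sup>s u0\<close> the chain rule leaves only
  \<open>-\<phi>\<^sub>r\<^sub>r(s, v) v\<^sub>x\<^sup>2\<close>; here \<open>\<bar>v\<^sub>x\<bar> \<le> D\<close>, and \<open>\<bar>\<phi>\<^sub>r\<^sub>r\<bar> \<le> s e\<^bsup>2sL\<^esup> M\<close> because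
  \<open>\<phi>\<^sub>r = exp (\<integral>\<^sub>0\<^sup>s f'(\<phi>))\<close> (\<open>flow_hessian_bound\<close>).

  Both \<open>u\<close> and \<open>w\<close> stay in \<open>[-\<kappa>, \<kappa>]\<close>, where \<open>f\<close> has Lipschitz constant \<open>L\<close>.  The maximum principle on the
  line therefore compares \<open>\<plusminus>(u - w)\<close> with the supersolution \<open>s\<^sup>2 e\<^bsup>2sL\<^esup> M D\<^sup>2 / 2\<close>, which vanishes at
  \<open>s = 0\<close> and is the asserted bound at \<open>s = t\<close> (\<open>approximate_solution_error\<close>).

  The derivative of \<open>u0\<close> may be unbounded.  Then the right-hand side is infinite unless \<open>t = 0\<close>, where there
  is nothing to show, or \<open>M = 0\<close>.  In the last case both residuals vanish whether or not \<open>u0\<close> is Lipschitz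
  continuous.  This is why several lemmas below assume that \<open>M = 0\<close> or that a Lipschitz bound holds.
\<close>

section \<open>The maximum principle on the line and the comparison of approximate solutions\<close>

lemma second_derivative_nonpos_at_local_max:
  fixes g g' :: "real \<Rightarrow> real"
  assumes g: "\<And>y. (g has_real_derivative g' y) (at y)"
    and g': "(g' has_real_derivative D) (at x)"
    and max: "d > 0" "\<And>y. \<bar>x - y\<bar> < d \<Longrightarrow> g y \<le> g x"
  shows "D \<le> 0"
proof (rule ccontr)
  assume "\<not> D \<le> 0"
  then have "D > 0" by simp
  have "g' x = 0"
    using DERIV_local_max[OF g max(1)] max(2) by blast
  then obtain \<delta> where \<delta>: "\<delta> > 0" "\<And>h. 0 < h \<Longrightarrow> h < \<delta> \<Longrightarrow> g' (x + h) > 0"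
    using DERIV_pos_inc_right[OF g' \<open>D > 0\<close>] by auto
  define h where "h = min \<delta> d / 2"
  have h: "0 < h" "h < \<delta>" "h < d"
    using \<delta>(1) max(1) by (auto simp: h_def min_def)
  obtain z where z: "x < z" "z < x + h" "g (x + h) - g x = (x + h - x) * g' z"
    using MVT2[of x "x + h" g g'] g h(1) by auto
  have "g' z > 0"
    using \<delta>(2)[of "z - x"] z h by auto
  then have "g (x + h) > g x"
    using z(3) h(1) by (metis add_diff_cancel_left' diff_gt_0_iff_gt mult_pos_pos)
  then show False
    using max(2)[of "x + h"] h by auto
qed

lemma derivative_nonneg_at_left_max:
  fixes g :: "real \<Rightarrow> real"
  assumes g: "(g has_real_derivative D) (at s)"
    and max: "a < s" "\<And>r. a \<le> r \<Longrightarrow> r \<le> s \<Longrightarrow> g r \<le> g s"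
  shows "D \<ge> 0"
proof (rule ccontr)
  assume "\<not> D \<ge> 0"
  then obtain \<delta> where \<delta>: "\<delta> > 0" "\<And>h. 0 < h \<Longrightarrow> h < \<delta> \<Longrightarrow> g s < g (s - h)"
    using DERIV_neg_dec_left[OF g] by auto
  define h where "h = min \<delta> (s - a) / 2"
  have "0 < h" "h < \<delta>" "h < s - a"
    using \<delta>(1) max(1) by (auto simp: h_def min_def)
  then show False
    using \<delta>(2)[of h] max(2)[of "s - h"] by auto
qed

text \<open>
  The damping factor \<open>exp (-Kt)\<close> absorbs the term \<open>L * e\<close>, and subtracting \<open>\<epsilon> (1 + x\<^sup>2)\<close> makes the bounded
  function negative for large \<open>\<bar>x\<bar>\<close>, so that a positive value forces a positive maximum on a compact
  rectangle.  There the derivative conditions at a maximum contradict the differential inequality, which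
  is only assumed where \<open>e\<close> is positive.
\<close>

lemma parabolic_maximum_principle:
  fixes e e_t e_x e_xx :: "real \<Rightarrow> real \<Rightarrow> real"
  assumes cont: "continuous_on ({0..S} \<times> UNIV) (\<lambda>(t, x). e t x)"
    and bdd: "\<And>t x. t \<in> {0..S} \<Longrightarrow> e t x \<le> C"
    and init: "\<And>x. e 0 x \<le> 0"
    and e_t: "\<And>t x. t \<in> {0<..S} \<Longrightarrow> ((\<lambda>s. e s x) has_real_derivative e_t t x) (at t)"
    and e_x: "\<And>t x. t \<in> {0<..S} \<Longrightarrow> (e t has_real_derivative e_x t x) (at x)"
    and e_xx: "\<And>t x. t \<in> {0<..S} \<Longrightarrow> (e_x t has_real_derivative e_xx t x) (at x)"
    and ineq: "\<And>t x. t \<in> {0<..S} \<Longrightarrow> e t x > 0 \<Longrightarrow> e_t t x - e_xx t x \<le> L * e t x"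
    and t: "t \<in> {0..S}"
  shows "e t x \<le> 0"
proof (rule ccontr)
  assume "\<not> e t x \<le> 0"
  then have pos: "e t x > 0" by simp
  \<comment> \<open>The summand \<open>2\<close> pays for the second derivative \<open>2 \<epsilon>\<close> of \<open>\<epsilon> (1 + x\<^sup>2)\<close>; \<open>\<epsilon>\<close> keeps \<open>p t x\<close> positive.\<close>
  define K where "K = \<bar>L\<bar> + 2"
  have "K \<ge> 0" by (simp add: K_def)
  define \<epsilon> where "\<epsilon> = e t x * exp (- K * t) / (2 * (1 + x\<^sup>2))"
  define p where "p = (\<lambda>s y. e s y * exp (- K * s) - \<epsilon> * (1 + y\<^sup>2))"
  have x2: "1 + x\<^sup>2 > 0" by (simp add: add_pos_nonneg)
  have \<epsilon>: "\<epsilon> > 0"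
    using pos x2 by (simp add: \<epsilon>_def)
  have "\<epsilon> * (1 + x\<^sup>2) = e t x * exp (- K * t) / 2"
    using x2 unfolding \<epsilon>_def by (simp only: nonzero_divide_eq_eq nonzero_eq_divide_eq) (simp add: field_simps)
  moreover have "e t x * exp (- K * t) > 0"
    using pos by simp
  ultimately have ptx: "p t x > 0"
    unfolding p_def by linarith
  \<comment> \<open>The bound \<open>e \<le> C\<close> is beaten by \<open>\<epsilon> x\<^sup>2\<close> from \<open>\<bar>x\<bar> = R\<close> on.\<close>
  define R where "R = \<bar>x\<bar> + \<bar>C\<bar> / \<epsilon> + 1"
  have "R \<ge> 1" "R \<ge> \<bar>C\<bar> / \<epsilon>" "\<bar>x\<bar> \<le> R"
    using \<epsilon> by (auto simp: R_def)
  have outer: "p s y \<le> 0" if "s \<in> {0..S}" "\<bar>y\<bar> = R" for s y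
  proof -
    have "\<bar>C\<bar> / \<epsilon> \<le> R * R"
      using \<open>R \<ge> 1\<close> \<open>R \<ge> \<bar>C\<bar> / \<epsilon>\<close> mult_right_mono[of 1 R R] by linarith
    also have "R * R = y\<^sup>2"
      using that(2) by (metis power2_abs power2_eq_square)
    finally have "\<bar>C\<bar> \<le> \<epsilon> * y\<^sup>2"
      using \<epsilon> by (simp add: field_simps)
    moreover have "e s y * exp (- K * s) \<le> \<bar>C\<bar> * 1"
    proof (rule order_trans[OF mult_right_mono mult_left_mono])
      show "e s y \<le> \<bar>C\<bar>" using bdd[OF that(1), of y] by linarith
      show "exp (- K * s) \<le> 1" using that(1) \<open>K \<ge> 0\<close> by simp
    qed auto
    ultimately show ?thesis
      using \<epsilon> by (simp add: p_def algebra_simps)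
  qed
  have "continuous_on ({0..S} \<times> {-R..R}) (\<lambda>(s, y). p s y)"
    unfolding p_def case_prod_unfold
    by (intro continuous_intros continuous_on_subset[OF cont[unfolded case_prod_unfold]]) auto
  moreover have "compact ({0..S} \<times> {-R..R})"
    by (intro compact_Times compact_Icc)
  moreover have "(t, x) \<in> {0..S} \<times> {-R..R}"
    using t \<open>\<bar>x\<bar> \<le> R\<close> by auto
  ultimately obtain s y where sy: "s \<in> {0..S}" "y \<in> {-R..R}"
    and max: "\<And>r z. r \<in> {0..S} \<Longrightarrow> z \<in> {-R..R} \<Longrightarrow> p r z \<le> p s y"
    using continuous_attains_sup[of "{0..S} \<times> {-R..R}" "\<lambda>(s, y). p s y"] by fastforce
  have "x \<in> {-R..R}"
    using \<open>\<bar>x\<bar> \<le> R\<close> by auto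
  then have psy: "p s y > 0"
    using max[OF t] ptx by fastforce
  have "\<bar>y\<bar> \<noteq> R"
    using outer[OF sy(1)] psy by force
  then have y: "\<bar>y\<bar> < R" using sy(2) by auto
  have "p 0 z \<le> 0" for z
  proof -
    have "0 \<le> \<epsilon> * (1 + z\<^sup>2)" using \<epsilon> by simp
    then show ?thesis using init[of z] by (simp add: p_def)
  qed
  then have "s \<noteq> 0"
    using psy by (metis not_less)
  then have s: "s \<in> {0<..S}" using sy(1) by auto
  have esy: "e s y * exp (- K * s) > \<epsilon>"
  proof -
    have "0 \<le> \<epsilon> * y\<^sup>2" using \<epsilon> by simp
    then show ?thesis using psy by (simp add: p_def algebra_simps)
  qed
  then have e_pos: "e s y > 0"
    using \<epsilon> by (smt (verit) exp_gt_zero zero_less_mult_pos2)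
  have "0 \<le> e_t s y * exp (- K * s) - K * e s y * exp (- K * s)"
  proof (rule derivative_nonneg_at_left_max[of "\<lambda>r. p r y" _ s 0])
    show "((\<lambda>r. p r y) has_real_derivative
        e_t s y * exp (- K * s) - K * e s y * exp (- K * s)) (at s)"
      unfolding p_def using s by (auto intro!: derivative_eq_intros e_t)
    show "0 < s" using s by simp
    show "p r y \<le> p s y" if "0 \<le> r" "r \<le> s" for r
      using max[of r y] that s sy by auto
  qed
  then have "K * e s y * exp (- K * s) \<le> e_t s y * exp (- K * s)"
    by linarith
  then have 1: "K * e s y \<le> e_t s y"
    by simp
  have "e_xx s y * exp (- K * s) - 2 * \<epsilon> \<le> 0"
  proof (rule second_derivative_nonpos_at_local_max[of "p s" _ _ y "R - \<bar>y\<bar>"])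
    show "(p s has_real_derivative e_x s z * exp (- K * s) - \<epsilon> * (2 * z)) (at z)" for z
      unfolding p_def using s by (auto intro!: derivative_eq_intros e_x)
    show "((\<lambda>z. e_x s z * exp (- K * s) - \<epsilon> * (2 * z)) has_real_derivative
        e_xx s y * exp (- K * s) - 2 * \<epsilon>) (at y)"
      using s by (auto intro!: derivative_eq_intros e_xx)
    show "p s z \<le> p s y" if "\<bar>y - z\<bar> < R - \<bar>y\<bar>" for z
    proof -
      have "z \<in> {-R..R}" using that by auto
      then show ?thesis by (rule max[OF sy(1)])
    qed
  qed (use y in auto)
  then have "e_xx s y * exp (- K * s) < 2 * e s y * exp (- K * s)"
    using esy by linarith
  then have 2: "e_xx s y < 2 * e s y"
    by (simp only: mult_less_cancel_right_pos[OF exp_gt_zero])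
  have "K * e s y - 2 * e s y < L * e s y"
    using ineq[OF s e_pos] 1 2 by linarith
  moreover have "L * e s y \<le> \<bar>L\<bar> * e s y"
    using e_pos by (intro mult_right_mono) auto
  ultimately show False
    by (simp add: K_def algebra_simps)
qed

lemma reaction_diffusion_solution_derivatives:
  assumes "reaction_diffusion_solution f u0 u" and "t > 0"
  shows "((\<lambda>s. u s x) has_real_derivative deriv (\<lambda>s. u s x) t) (at t)"
    and "(u t has_real_derivative deriv (u t) x) (at x)"
    and "(deriv (u t) has_real_derivative deriv (deriv (u t)) x) (at x)"
    and "deriv (\<lambda>s. u s x) t - deriv (deriv (u t)) x = f (u t x)"
  using assms by (auto simp: reaction_diffusion_solution_def DERIV_deriv_iff_real_differentiable)

text \<open>
  Wherever \<open>u\<close> exceeds \<open>\<kappa> \<ge> 1\<close> the reaction term points inwards, so \<open>u - \<kappa>\<close> and \<open>-u - \<kappa>\<close> satisfy the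
  hypotheses of the maximum principle.  A sign \<open>\<sigma>\<close> treats the two bounds together.
\<close>

lemma reaction_diffusion_solution_invariant_interval:
  assumes sol: "reaction_diffusion_solution f u0 u"
    and dissipative: "\<And>r. \<bar>r\<bar> \<ge> 1 \<Longrightarrow> r * f r \<le> 0"
    and \<kappa>: "\<kappa> \<ge> 1" "\<And>x. \<bar>u0 x\<bar> \<le> \<kappa>"
    and t: "t \<ge> 0"
  shows "\<bar>u t x\<bar> \<le> \<kappa>"
proof -
  note derivs = reaction_diffusion_solution_derivatives[OF sol]
  have cont: "continuous_on ({0..t} \<times> UNIV) (\<lambda>(t, x). u t x)"
    using sol by (auto simp: reaction_diffusion_solution_def intro: continuous_on_subset)
  have "bounded ((\<lambda>(t, x). u t x) ` ({0..t} \<times> UNIV))"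
    using sol by (auto simp: reaction_diffusion_solution_def)
  then obtain C where C: "\<And>s x. s \<in> {0..t} \<Longrightarrow> \<bar>u s x\<bar> \<le> C"
    by (fastforce simp: bounded_iff)
  have "\<sigma> * u t x - \<kappa> \<le> 0" if \<sigma>: "\<bar>\<sigma>\<bar> = 1" for \<sigma>
  proof (rule parabolic_maximum_principle[where S = t and L = 0 and C = C
        and e = "\<lambda>s y. \<sigma> * u s y - \<kappa>" and e_t = "\<lambda>s y. \<sigma> * deriv (\<lambda>s. u s y) s"
        and e_x = "\<lambda>s y. \<sigma> * deriv (u s) y" and e_xx = "\<lambda>s y. \<sigma> * deriv (deriv (u s)) y"])
    have abs_\<sigma>: "\<sigma> * r \<le> \<bar>r\<bar>" for r
      using \<sigma> abs_ge_self[of "\<sigma> * r"] by (simp add: abs_mult)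
    show "continuous_on ({0..t} \<times> UNIV) (\<lambda>(s, y). \<sigma> * u s y - \<kappa>)"
      using cont by (auto simp: case_prod_unfold intro!: continuous_intros)
    show "\<sigma> * u s y - \<kappa> \<le> C" if "s \<in> {0..t}" for s y
      using C[OF that, of y] abs_\<sigma>[of "u s y"] \<kappa>(1) by linarith
    show "\<sigma> * u 0 y - \<kappa> \<le> 0" for y
      using sol \<kappa>(2)[of y] abs_\<sigma>[of "u0 y"] by (simp add: reaction_diffusion_solution_def)
    show "\<sigma> * deriv (\<lambda>s. u s y) s - \<sigma> * deriv (deriv (u s)) y \<le> 0 * (\<sigma> * u s y - \<kappa>)"
      if s: "s \<in> {0<..t}" and pos: "\<sigma> * u s y - \<kappa> > 0" for s y
    proof -
      have "\<sigma> * u s y > 1" using pos \<kappa>(1) by linarith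
      moreover have "\<sigma> * u s y \<le> \<bar>u s y\<bar>" by (rule abs_\<sigma>)
      ultimately have "u s y * f (u s y) \<le> 0"
        by (intro dissipative) linarith
      moreover have "\<sigma> * \<sigma> = 1"
        using \<sigma> by (metis abs_mult_self_eq mult_1)
      ultimately have "(\<sigma> * u s y) * (\<sigma> * f (u s y)) \<le> 0"
        by (metis (no_types, lifting) mult.assoc mult.left_commute mult_1)
      then have "\<sigma> * f (u s y) \<le> 0"
        using \<open>\<sigma> * u s y > 1\<close> by (smt (verit) mult_pos_pos)
      then show ?thesis
        using derivs(4)[of s y] s by (simp flip: right_diff_distrib)
    qed
  qed (use t derivs in \<open>auto intro!: derivative_eq_intros\<close>)
  from this[of 1] this[of "-1"] show ?thesis by auto
qed

text \<open>
  The error is compared with \<open>B(s) = s\<^sup>2 e\<^bsup>2sL\<^esup> A / 2\<close>.  Its derivative is \<open>s e\<^bsup>2sL\<^esup> A + 2 L B(s)\<close>, which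
  pays for the residual and for the growth \<open>L B(s)\<close> that the reaction term can produce.
\<close>

lemma approximate_solution_error:
  assumes sol: "reaction_diffusion_solution f u0 u"
    and u: "\<And>s x. s \<ge> 0 \<Longrightarrow> \<bar>u s x\<bar> \<le> \<kappa>"
    and w: "\<And>s x. s \<ge> 0 \<Longrightarrow> \<bar>w s x\<bar> \<le> \<kappa>"
    and lip: "\<And>a b. \<bar>a\<bar> \<le> \<kappa> \<Longrightarrow> \<bar>b\<bar> \<le> \<kappa> \<Longrightarrow> \<bar>f a - f b\<bar> \<le> L * \<bar>a - b\<bar>"
    and nonneg: "L \<ge> 0" "A \<ge> 0" "t \<ge> 0"
    and init: "\<And>x. w 0 x = u0 x"
    and cont: "continuous_on ({0..} \<times> UNIV) (\<lambda>(s, x). w s x)"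
    and w_t: "\<And>s x. s > 0 \<Longrightarrow> ((\<lambda>s. w s x) has_real_derivative w_t s x) (at s)"
    and w_x: "\<And>s x. s > 0 \<Longrightarrow> (w s has_real_derivative w_x s x) (at x)"
    and w_xx: "\<And>s x. s > 0 \<Longrightarrow> (w_x s has_real_derivative w_xx s x) (at x)"
    and residual: "\<And>s x. s > 0 \<Longrightarrow> \<bar>w_t s x - w_xx s x - f (w s x)\<bar> \<le> s * exp (2 * s * L) * A"
  shows "\<bar>u t x - w t x\<bar> \<le> t\<^sup>2 * exp (2 * t * L) * A / 2"
proof -
  define B where "B = (\<lambda>s. s\<^sup>2 * exp (2 * s * L) * A / 2)"
  define B' where "B' = (\<lambda>s. s * exp (2 * s * L) * A + s\<^sup>2 * L * exp (2 * s * L) * A)"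
  have B: "(B has_real_derivative B' s) (at s)" for s
    unfolding B_def B'_def by (auto intro!: derivative_eq_intros simp: algebra_simps power2_eq_square)
  have B_nonneg: "B s \<ge> 0" for s
    using nonneg by (simp add: B_def)
  have B_super: "s * exp (2 * s * L) * A + L * B s \<le> B' s" for s
    using nonneg by (simp add: B_def B'_def field_simps)
  note derivs = reaction_diffusion_solution_derivatives[OF sol]
  have cont_u: "continuous_on ({0..t} \<times> UNIV) (\<lambda>(t, x). u t x)"
    using sol by (auto simp: reaction_diffusion_solution_def intro: continuous_on_subset)
  have cont_w: "continuous_on ({0..t} \<times> UNIV) (\<lambda>(t, x). w t x)"
    using cont by (rule continuous_on_subset) auto
  have signed: "\<sigma> * (u t x - w t x) - B t \<le> 0" if \<sigma>: "\<bar>\<sigma>\<bar> = 1" for \<sigma>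
  proof (rule parabolic_maximum_principle[where S = t and L = L and C = "2 * \<kappa>"
        and e = "\<lambda>s y. \<sigma> * (u s y - w s y) - B s"
        and e_t = "\<lambda>s y. \<sigma> * (deriv (\<lambda>s. u s y) s - w_t s y) - B' s"
        and e_x = "\<lambda>s y. \<sigma> * (deriv (u s) y - w_x s y)"
        and e_xx = "\<lambda>s y. \<sigma> * (deriv (deriv (u s)) y - w_xx s y)"])
    have abs_\<sigma>: "\<sigma> * r \<le> \<bar>r\<bar>" for r
      using \<sigma> abs_ge_self[of "\<sigma> * r"] by (simp add: abs_mult)
    show "continuous_on ({0..t} \<times> UNIV) (\<lambda>(s, y). \<sigma> * (u s y - w s y) - B s)"
      using cont_u cont_w unfolding B_def case_prod_unfold by (intro continuous_intros) auto
    show "\<sigma> * (u s y - w s y) - B s \<le> 2 * \<kappa>" if "s \<in> {0..t}" for s y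
      using u[of s y] w[of s y] that abs_\<sigma>[of "u s y - w s y"] B_nonneg[of s] by auto
    show "\<sigma> * (u 0 y - w 0 y) - B 0 \<le> 0" for y
      using sol B_nonneg[of 0] by (simp add: reaction_diffusion_solution_def init)
    show "\<sigma> * (deriv (\<lambda>s. u s y) s - w_t s y) - B' s - \<sigma> * (deriv (deriv (u s)) y - w_xx s y)
        \<le> L * (\<sigma> * (u s y - w s y) - B s)"
      if s: "s \<in> {0<..t}" and pos: "\<sigma> * (u s y - w s y) - B s > 0" for s y
    proof -
      have s0: "s > 0" using s by simp
      have "\<sigma> * (u s y - w s y) > 0"
        using pos B_nonneg[of s] by linarith
      then have abs_eq: "\<bar>u s y - w s y\<bar> = \<sigma> * (u s y - w s y)"
        using \<sigma> by (metis abs_mult abs_of_pos mult_1)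
      have "\<sigma> * (f (u s y) - f (w s y)) \<le> \<bar>f (u s y) - f (w s y)\<bar>"
        by (rule abs_\<sigma>)
      also have "\<dots> \<le> L * (\<sigma> * (u s y - w s y))"
        using lip[OF u w, of s s y y] s0 by (simp add: abs_eq)
      finally have 1: "\<sigma> * (f (u s y) - f (w s y)) \<le> L * (\<sigma> * (u s y - w s y))" .
      have 2: "\<sigma> * - (w_t s y - w_xx s y - f (w s y)) \<le> s * exp (2 * s * L) * A"
        using abs_\<sigma>[of "- (w_t s y - w_xx s y - f (w s y))"] residual[OF s0, of y] by linarith
      have "\<sigma> * (deriv (\<lambda>s. u s y) s - w_t s y) - \<sigma> * (deriv (deriv (u s)) y - w_xx s y)
          = \<sigma> * (f (u s y) - f (w s y)) + \<sigma> * - (w_t s y - w_xx s y - f (w s y))"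
        unfolding derivs(4)[OF s0, of y, symmetric] by (simp add: algebra_simps)
      then show ?thesis
        using 1 2 B_super[of s] by (simp add: right_diff_distrib)
    qed
  qed (use nonneg derivs w_t w_x w_xx B in \<open>auto intro!: derivative_eq_intros simp: mult.commute\<close>)
  have "\<bar>u t x - w t x\<bar> \<le> B t"
    using signed[of 1] signed[of "-1"] by simp
  then show ?thesis by (simp add: B_def)
qed

section \<open>Global solutions of a Lipschitz ordinary differential equation\<close>

lemma integral_has_real_derivative_atLeast:
  fixes F :: "real \<Rightarrow> real"
  assumes F: "continuous_on {0..} F" and t: "t \<ge> 0"
  shows "((\<lambda>t. integral {0..t} F) has_real_derivative F t) (at t within {0..})"
proof -
  have "((\<lambda>t. integral {0..t} F) has_real_derivative F t) (at t within {0..t + 1})"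
    using t by (intro integral_has_real_derivative continuous_on_subset[OF F]) auto
  moreover have "at t within {0..} = at t within {0..t + 1}"
    using t by (intro at_within_nhd[of t "{..<t + 1}"]) auto
  ultimately show ?thesis by simp
qed

text \<open>
  Picard iteration.  In the unknown \<open>h(t) = e\<^bsup>-Kt\<^esup> w(t)\<close> with \<open>K = 2L\<close> the Picard operator is a contraction
  with factor \<open>1/2\<close> on bounded continuous functions, which gives a solution for all times at once.
  Bounded continuous functions live on the whole line, so the operator is extended to negative times by
  its value at \<open>0\<close>.
\<close>

lemma lipschitz_ode_solution_exists:
  fixes g :: "real \<Rightarrow> real"
  assumes lip: "\<And>x y. \<bar>g x - g y\<bar> \<le> L * \<bar>x - y\<bar>" and L: "L > 0"
    and bound: "\<And>x. \<bar>g x\<bar> \<le> B"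
  shows "\<exists>w. w 0 = r \<and> (\<forall>t\<ge>0. (w has_real_derivative g (w t)) (at t within {0..}))"
proof -
  define K where "K = 2 * L"
  have K: "K > 0" using L by (simp add: K_def)
  have B0: "B \<ge> 0" using bound[of 0] by linarith
  have cont_g: "continuous_on UNIV g"
  proof (rule lipschitz_on_continuous_on[OF lipschitz_onI])
    show "dist (g x) (g y) \<le> L * dist x y" for x y
      using lip by (simp add: dist_real_def)
  qed (use L in auto)
  define F where "F = (\<lambda>(h :: real \<Rightarrow>\<^sub>C real) s. g (exp (K * s) * h s))"
  have cont_F: "continuous_on A (F h)" for h A
    unfolding F_def
    by (intro continuous_on_compose2[OF cont_g] continuous_intros continuous_on_apply_bcontfun) auto
  define I where "I = (\<lambda>h \<tau>. r + integral {0..\<tau>} (F h))"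
  \<comment> \<open>The Picard operator in the unknown \<open>h(t) = exp (- K t) w(t)\<close>.\<close>
  define P where "P = (\<lambda>h t. exp (- K * max t 0) * I h (max t 0))"
  have deriv_I: "(I h has_real_derivative F h t) (at t within {0..})" if "t \<ge> 0" for h t
    unfolding I_def
    using integral_has_real_derivative_atLeast[OF cont_F that] by (auto intro!: derivative_eq_intros)
  have P_bcontfun: "P h \<in> bcontfun" for h
  proof (rule bcontfun_normI)
    have "continuous_on {0..} (I h)"
      by (rule DERIV_continuous_on[OF deriv_I]) auto
    then have "continuous_on UNIV (\<lambda>t. I h (max t 0))"
      by (rule continuous_on_compose2) (auto intro!: continuous_intros)
    then show "continuous_on UNIV (P h)"
      unfolding P_def by (intro continuous_intros)
    show "norm (P h t) \<le> \<bar>r\<bar> + B / K" for t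
    proof -
      define \<tau> where "\<tau> = max t 0"
      have \<tau>: "\<tau> \<ge> 0" by (simp add: \<tau>_def)
      have "norm (integral {0..\<tau>} (F h)) \<le> B * (\<tau> - 0)"
        using bound by (intro integral_bound cont_F) (auto simp: \<tau> F_def)
      then have "\<bar>I h \<tau>\<bar> \<le> \<bar>r\<bar> + B * \<tau>"
        by (simp add: I_def)
      moreover have "\<tau> \<le> exp (K * \<tau>) / K"
      proof -
        have "\<tau> * K \<le> exp (K * \<tau>)"
          using exp_ge_add_one_self[of "K * \<tau>"] by (subst mult.commute) linarith
        then show ?thesis using K by (simp add: pos_le_divide_eq)
      qed
      then have "B * \<tau> \<le> B / K * exp (K * \<tau>)"
        using B0 mult_left_mono[of \<tau> "exp (K * \<tau>) / K" B] by simp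
      moreover have "\<bar>r\<bar> \<le> \<bar>r\<bar> * exp (K * \<tau>)"
        using K \<tau> mult_left_mono[of 1 "exp (K * \<tau>)" "\<bar>r\<bar>"] by simp
      ultimately have "\<bar>I h \<tau>\<bar> \<le> (\<bar>r\<bar> + B / K) * exp (K * \<tau>)"
        by (simp add: distrib_right)
      then show ?thesis
        unfolding P_def \<tau>_def[symmetric] by (simp add: abs_mult exp_minus field_simps)
    qed
  qed
  define Q where "Q = (\<lambda>h. Bcontfun (P h))"
  have Q: "apply_bcontfun (Q h) = P h" for h
    unfolding Q_def by (rule Bcontfun_inverse[OF P_bcontfun])
  have contraction: "dist (Q h) (Q k) \<le> 1/2 * dist h k" for h k
  proof (rule dist_bound)
    fix t :: real
    define \<tau> where "\<tau> = max t 0"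
    have \<tau>: "\<tau> \<ge> 0" by (simp add: \<tau>_def)
    define D where "D = dist h k"
    have D: "\<bar>h s - k s\<bar> \<le> D" for s
      using dist_bounded[of h s k] by (simp add: D_def dist_real_def)
    have int_exp: "((\<lambda>s. L * (exp (K * s) * D)) has_integral D / 2 * exp (K * \<tau>) - D / 2 * exp (K * 0)) {0..\<tau>}"
      using \<tau> L by (intro fundamental_theorem_of_calculus)
        (auto intro!: derivative_eq_intros simp: K_def has_real_derivative_iff_has_vector_derivative[symmetric])
    have "I h \<tau> - I k \<tau> = integral {0..\<tau>} (\<lambda>s. F h s - F k s)"
      unfolding I_def by (subst integral_diff) (auto intro!: integrable_continuous_interval cont_F)
    also have "norm \<dots> \<le> integral {0..\<tau>} (\<lambda>s. L * (exp (K * s) * D))"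
    proof (rule integral_norm_bound_integral)
      show "(\<lambda>s. F h s - F k s) integrable_on {0..\<tau>}"
        by (intro integrable_continuous_interval continuous_intros cont_F)
      show "(\<lambda>s. L * (exp (K * s) * D)) integrable_on {0..\<tau>}"
        using int_exp by blast
      show "norm (F h s - F k s) \<le> L * (exp (K * s) * D)" if "s \<in> {0..\<tau>}" for s
      proof -
        have "norm (F h s - F k s) \<le> L * \<bar>exp (K * s) * h s - exp (K * s) * k s\<bar>"
          unfolding F_def using lip by simp
        also have "\<bar>exp (K * s) * h s - exp (K * s) * k s\<bar> = exp (K * s) * \<bar>h s - k s\<bar>"
          by (simp add: abs_mult flip: right_diff_distrib)
        also have "L * (exp (K * s) * \<bar>h s - k s\<bar>) \<le> L * (exp (K * s) * D)"
          using D L by (intro mult_left_mono) auto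
        finally show ?thesis .
      qed
    qed
    also have "\<dots> = D / 2 * exp (K * \<tau>) - D / 2 * exp (K * 0)"
      using int_exp by (rule integral_unique)
    also have "\<dots> \<le> D / 2 * exp (K * \<tau>)"
      by (simp add: D_def)
    finally have "\<bar>I h \<tau> - I k \<tau>\<bar> \<le> D / 2 * exp (K * \<tau>)" by simp
    then have "exp (- K * \<tau>) * \<bar>I h \<tau> - I k \<tau>\<bar> \<le> D / 2"
      by (simp add: exp_minus field_simps)
    then show "dist (Q h t) (Q k t) \<le> 1/2 * dist h k"
      unfolding Q P_def \<tau>_def[symmetric] D_def[symmetric] dist_real_def
      by (simp add: abs_mult flip: right_diff_distrib)
  qed
  obtain h where h: "Q h = h"
    using banach_fix_type[of "1/2" Q] contraction by (metis half_gt_zero_iff less_imp_le zero_less_one field_sum_of_halves less_add_same_cancel1)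
  define w where "w = (\<lambda>t. exp (K * t) * h t)"
  have w_eq: "w t = I h t" if "t \<ge> 0" for t
  proof -
    have "h t = P h t" using Q[of h] h by simp
    then show ?thesis
      using that by (simp add: w_def P_def exp_minus)
  qed
  have "(w has_real_derivative g (w t)) (at t within {0..})" if "t \<ge> 0" for t
  proof (rule has_field_derivative_transform_within[where f = "I h" and d = 1])
    show "(I h has_real_derivative g (w t)) (at t within {0..})"
      using deriv_I[OF that, of h] by (simp add: F_def w_def)
  qed (use that w_eq in auto)
  moreover have "w 0 = r"
    using w_eq[of 0] by (simp add: I_def)
  ultimately show ?thesis by blast
qed

section \<open>The reaction flow\<close>

lemma at_within_atLeast_eq_at:
  fixes s :: real
  assumes "s > 0"
  shows "at s within {0..} = at s"
proof -
  have "{0..} \<inter> {0<..} - {s} = UNIV \<inter> {0<..} - {s}"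
    by auto
  then show ?thesis
    using at_within_nhd[of s "{0<..}" "{0..}" UNIV] assms by simp
qed

lemma continuous_on_if_lipschitz_on_strips:
  fixes h :: "real \<Rightarrow> real \<Rightarrow> real"
  assumes cont: "\<And>r. continuous_on {0..} (\<lambda>t. h t r)"
    and lip: "\<And>S K. S \<ge> 0 \<Longrightarrow> K \<ge> 1 \<Longrightarrow>
      \<exists>C. \<forall>t\<in>{0..S}. \<forall>r\<in>{-K..K}. \<forall>q\<in>{-K..K}. \<bar>h t r - h t q\<bar> \<le> C * \<bar>r - q\<bar>"
  shows "continuous_on ({0..} \<times> UNIV) (\<lambda>(t, r). h t r)"
proof (rule continuous_on_TimesI)
  show "local_lipschitz {0..} UNIV h"
  proof (rule local_lipschitzI)
    fix t x :: real
    assume "t \<in> {0..}"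
    then have "t + 1 \<ge> 0" "\<bar>x\<bar> + 1 \<ge> 1" by auto
    from lip[OF this] obtain C where C: "\<forall>s\<in>{0..t + 1}. \<forall>r\<in>{- (\<bar>x\<bar> + 1)..\<bar>x\<bar> + 1}.
        \<forall>q\<in>{- (\<bar>x\<bar> + 1)..\<bar>x\<bar> + 1}. \<bar>h s r - h s q\<bar> \<le> C * \<bar>r - q\<bar>"
      by blast
    have "\<bar>C\<bar>-lipschitz_on (cball x 1 \<inter> UNIV) (h s)" if "s \<in> cball t 1 \<inter> {0..}" for s
    proof (rule lipschitz_onI)
      fix r q assume "r \<in> cball x 1 \<inter> UNIV" "q \<in> cball x 1 \<inter> UNIV"
      then have "\<bar>h s r - h s q\<bar> \<le> C * \<bar>r - q\<bar>"
        using that by (intro C[rule_format]) (auto simp: dist_real_def)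
      also have "\<dots> \<le> \<bar>C\<bar> * \<bar>r - q\<bar>"
        by (intro mult_right_mono) auto
      finally show "dist (h s r) (h s q) \<le> \<bar>C\<bar> * dist r q"
        by (simp add: dist_real_def)
    qed simp
    then show "\<exists>u>0. \<exists>L. \<forall>s\<in>cball t u \<inter> {0..}. L-lipschitz_on (cball x u \<inter> UNIV) (h s)"
      by (intro exI[of _ "1::real"] conjI exI[of _ "\<bar>C\<bar>"] ballI) auto
  qed
qed (use cont in auto)

text \<open>
  After the last time at which \<open>w \<le> K\<close> holds, \<open>w\<close> can only decrease.
\<close>

lemma barrier_not_crossed:
  fixes w :: "real \<Rightarrow> real"
  assumes cont: "continuous_on {0..t} w" and "t \<ge> 0" and init: "w 0 \<le> K"
    and deriv: "\<And>s. 0 < s \<Longrightarrow> s < t \<Longrightarrow> w s > K \<Longrightarrow> \<exists>D. (w has_real_derivative D) (at s) \<and> D \<le> 0"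
  shows "w t \<le> K"
proof (rule ccontr)
  assume above: "\<not> w t \<le> K"
  define S where "S = {s \<in> {0..t}. w s \<le> K}"
  have "S = {0..t} \<inter> w -` {..K}"
    by (auto simp: S_def)
  then have "closed S"
    using continuous_closed_preimage[OF cont] by simp
  moreover have "bounded S"
    unfolding S_def by (rule bounded_subset[of "{0..t}"]) auto
  ultimately have "compact S"
    by (simp add: compact_eq_bounded_closed)
  moreover have "S \<noteq> {}"
    using init \<open>t \<ge> 0\<close> by (auto simp: S_def)
  ultimately obtain a where a: "a \<in> S" "\<And>s. s \<in> S \<Longrightarrow> s \<le> a"
    using compact_attains_sup[of S] by metis
  have "w t \<le> w a"
  proof (rule DERIV_nonpos_imp_decreasing_open[where f = w and a = a and b = t])
    show "a \<le> t" using a(1) by (simp add: S_def)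
    show "\<exists>D. (w has_real_derivative D) (at s) \<and> D \<le> 0" if "a < s" "s < t" for s
    proof -
      have "s \<notin> S" using a(2) that by fastforce
      then show ?thesis using that a(1) by (intro deriv) (auto simp: S_def)
    qed
    show "continuous_on {a..t} w"
      using cont a(1) by (auto simp: S_def intro: continuous_on_subset)
  qed
  then show False
    using a(1) above by (simp add: S_def)
qed

lemma continuous_on_ode_solution:
  fixes w :: "real \<Rightarrow> real"
  assumes "\<And>s. s \<ge> 0 \<Longrightarrow> (w has_real_derivative g (w s)) (at s within {0..})"
  shows "continuous_on {0..t} w"
proof (rule continuous_on_subset)
  show "continuous_on {0..} w"
    by (rule DERIV_continuous_on[where D = "\<lambda>s. g (w s)"]) (use assms in auto)
qed auto

lemma ode_invariant_interval:
  fixes w g :: "real \<Rightarrow> real"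
  assumes sol: "\<And>s. s \<ge> 0 \<Longrightarrow> (w has_real_derivative g (w s)) (at s within {0..})"
    and t: "t \<ge> 0" and init: "\<bar>w 0\<bar> \<le> K"
    and inward: "\<And>r. r > K \<Longrightarrow> g r \<le> 0" "\<And>r. r < -K \<Longrightarrow> g r \<ge> 0"
  shows "\<bar>w t\<bar> \<le> K"
proof -
  have cont: "continuous_on {0..t} w"
    using sol by (rule continuous_on_ode_solution)
  have deriv: "(w has_real_derivative g (w s)) (at s)" if "s > 0" for s
    using sol[of s] that by (simp add: at_within_atLeast_eq_at)
  have "w t \<le> K"
    by (rule barrier_not_crossed[OF cont t]) (use init inward deriv in auto)
  moreover have "- w t \<le> K"
  proof (rule barrier_not_crossed[where w = "\<lambda>s. - w s", OF _ t])
    fix s assume "0 < s" "- w s > K"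
    then show "\<exists>D. ((\<lambda>s. - w s) has_real_derivative D) (at s) \<and> D \<le> 0"
      using DERIV_minus[OF deriv[of s]] inward(2)[of "w s"] by (intro exI[of _ "- g (w s)"]) auto
  qed (use init cont in \<open>auto intro: continuous_on_minus\<close>)
  ultimately show ?thesis by auto
qed

text \<open>
  The function \<open>(w - v)\<^sup>2 exp (-2Ls)\<close> is nonincreasing.
\<close>

lemma ode_solutions_gronwall:
  fixes w v g :: "real \<Rightarrow> real"
  assumes w: "\<And>s. s \<ge> 0 \<Longrightarrow> (w has_real_derivative g (w s)) (at s within {0..})"
    and v: "\<And>s. s \<ge> 0 \<Longrightarrow> (v has_real_derivative g (v s)) (at s within {0..})"
    and range: "\<And>s. s \<in> {0..t} \<Longrightarrow> \<bar>w s\<bar> \<le> K" "\<And>s. s \<in> {0..t} \<Longrightarrow> \<bar>v s\<bar> \<le> K"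
    and lip: "\<And>a b. \<bar>a\<bar> \<le> K \<Longrightarrow> \<bar>b\<bar> \<le> K \<Longrightarrow> \<bar>g a - g b\<bar> \<le> L * \<bar>a - b\<bar>"
    and t: "t \<ge> 0"
  shows "\<bar>w t - v t\<bar> \<le> exp (L * t) * \<bar>w 0 - v 0\<bar>"
proof -
  define E where "E = (\<lambda>s. (w s - v s)\<^sup>2 * exp (- 2 * L * s))"
  have cont_w: "continuous_on {0..t} w"
    using w by (rule continuous_on_ode_solution)
  have cont_v: "continuous_on {0..t} v"
    using v by (rule continuous_on_ode_solution)
  have "E t \<le> E 0"
  proof (rule DERIV_nonpos_imp_decreasing_open[OF t])
    fix s assume s: "0 < s" "s < t"
    define d where "d = w s - v s"
    define D where "D = g (w s) - g (v s)"
    have "((\<lambda>s. w s) has_real_derivative g (w s)) (at s)" "((\<lambda>s. v s) has_real_derivative g (v s)) (at s)"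
      using w[of s] v[of s] s by (simp_all add: at_within_atLeast_eq_at)
    then have "(E has_real_derivative (2 * d * D - 2 * L * d\<^sup>2) * exp (- 2 * L * s)) (at s)"
      unfolding E_def d_def D_def
      by (auto intro!: derivative_eq_intros simp: algebra_simps power2_eq_square)
    moreover have "d * D \<le> L * d\<^sup>2"
    proof -
      have "d * D \<le> \<bar>d\<bar> * \<bar>D\<bar>" by (metis abs_ge_self abs_mult)
      also have "\<dots> \<le> \<bar>d\<bar> * (L * \<bar>d\<bar>)"
        unfolding d_def D_def using range[of s] s by (intro mult_left_mono lip) auto
      also have "\<dots> = L * d\<^sup>2"
        by (simp add: power2_eq_square mult.left_commute)
      finally show ?thesis .
    qed
    then have "(2 * d * D - 2 * L * d\<^sup>2) * exp (- 2 * L * s) \<le> 0"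
      by (intro mult_nonpos_nonneg) auto
    ultimately show "\<exists>D. (E has_real_derivative D) (at s) \<and> D \<le> 0" by blast
  next
    show "continuous_on {0..t} E"
      unfolding E_def by (intro continuous_intros cont_w cont_v)
  qed
  then have "(w t - v t)\<^sup>2 \<le> exp (2 * L * t) * (w 0 - v 0)\<^sup>2"
    by (simp add: E_def exp_minus field_simps)
  also have "\<dots> = (exp (L * t) * \<bar>w 0 - v 0\<bar>)\<^sup>2"
    by (simp add: power_mult_distrib exp_double[symmetric] mult.assoc)
  finally have "\<bar>w t - v t\<bar>\<^sup>2 \<le> (exp (L * t) * \<bar>w 0 - v 0\<bar>)\<^sup>2"
    by simp
  then show ?thesis
    by (rule power2_le_imp_le) simp
qed

locale dissipative_reaction =
  fixes f f' f'' :: "real \<Rightarrow> real"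
  assumes f': "\<And>r. (f has_real_derivative f' r) (at r)"
    and f'': "\<And>r. (f' has_real_derivative f'' r) (at r)"
    and continuous_f'': "continuous_on UNIV f''"
    and dissipative: "\<And>r. \<bar>r\<bar> \<ge> 1 \<Longrightarrow> r * f r \<le> 0"
begin

lemma continuous_f: "continuous_on A f"
  using f' by (meson DERIV_isCont continuous_at_imp_continuous_on)

lemma continuous_f': "continuous_on A f'"
  using f'' by (meson DERIV_isCont continuous_at_imp_continuous_on)

lemma f_bounded: "\<exists>B. \<forall>x. \<bar>x\<bar> \<le> K \<longrightarrow> \<bar>f x\<bar> \<le> B"
proof -
  have "bounded (f ` {-K..K})"
    by (intro compact_imp_bounded compact_continuous_image continuous_f compact_Icc)
  then obtain B where "\<forall>x\<in>{-K..K}. \<bar>f x\<bar> \<le> B"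
    by (auto simp: bounded_iff)
  moreover have "x \<in> {-K..K}" if "\<bar>x\<bar> \<le> K" for x
    using that by auto
  ultimately show ?thesis by blast
qed

lemma f'_bounded: "\<exists>L>0. \<forall>x. \<bar>x\<bar> \<le> K \<longrightarrow> \<bar>f' x\<bar> \<le> L"
proof -
  have "bounded (f' ` {-K..K})"
    by (intro compact_imp_bounded compact_continuous_image continuous_f' compact_Icc)
  then show ?thesis
    by (auto simp: bounded_pos abs_le_iff)
qed

lemma f''_bounded: "\<exists>M>0. \<forall>x. \<bar>x\<bar> \<le> K \<longrightarrow> \<bar>f'' x\<bar> \<le> M"
proof -
  have "bounded (f'' ` {-K..K})"
    by (intro compact_imp_bounded compact_continuous_image compact_Icc
        continuous_on_subset[OF continuous_f'']) simp
  then show ?thesis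
    by (auto simp: bounded_pos abs_le_iff)
qed

lemma f_lipschitz:
  assumes "\<And>x. \<bar>x\<bar> \<le> K \<Longrightarrow> \<bar>f' x\<bar> \<le> L" and "\<bar>a\<bar> \<le> K" "\<bar>b\<bar> \<le> K"
  shows "\<bar>f a - f b\<bar> \<le> L * \<bar>a - b\<bar>"
proof -
  have "norm (f a - f b) \<le> L * norm (a - b)"
  proof (rule field_differentiable_bound[of "{-K..K}" _ f'])
    fix z assume "z \<in> {-K..K}"
    then have "\<bar>z\<bar> \<le> K" by auto
    then show "norm (f' z) \<le> L" using assms(1) by simp
  qed (use assms(2,3) in \<open>auto intro: has_field_derivative_at_within[OF f']\<close>)
  then show ?thesis by simp
qed

lemma f'_lipschitz:
  assumes "\<And>x. \<bar>x\<bar> \<le> K \<Longrightarrow> \<bar>f'' x\<bar> \<le> M" and "\<bar>a\<bar> \<le> K" "\<bar>b\<bar> \<le> K"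
  shows "\<bar>f' a - f' b\<bar> \<le> M * \<bar>a - b\<bar>"
proof -
  have "norm (f' a - f' b) \<le> M * norm (a - b)"
  proof (rule field_differentiable_bound[of "{-K..K}" _ f''])
    fix z assume "z \<in> {-K..K}"
    then have "\<bar>z\<bar> \<le> K" by auto
    then show "norm (f'' z) \<le> M" using assms(1) by simp
  qed (use assms(2,3) in \<open>auto intro: has_field_derivative_at_within[OF f'']\<close>)
  then show ?thesis by simp
qed

lemma taylor_remainder:
  assumes M: "\<And>x. \<bar>x\<bar> \<le> K \<Longrightarrow> \<bar>f'' x\<bar> \<le> M" and ab: "\<bar>a\<bar> \<le> K" "\<bar>b\<bar> \<le> K"
  shows "\<bar>f b - f a - f' a * (b - a)\<bar> \<le> M / 2 * (b - a)\<^sup>2"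
proof (cases "a = b")
  case False
  define diff where "diff = (\<lambda>m::nat. if m = 0 then f else if m = 1 then f' else f'')"
  have "\<exists>t. (if b < a then b < t \<and> t < a else a < t \<and> t < b) \<and>
      f b = (\<Sum>m<2. diff m a / fact m * (b - a) ^ m) + diff 2 t / fact 2 * (b - a) ^ 2"
  proof (rule Taylor[where a = "-K" and b = K])
    show "\<forall>m t. m < 2 \<and> -K \<le> t \<and> t \<le> K \<longrightarrow> (diff m has_real_derivative diff (Suc m) t) (at t)"
      using f' f'' by (auto simp: diff_def less_2_cases_iff)
  qed (use ab False in \<open>auto simp: diff_def\<close>)
  then obtain t where t: "if b < a then b < t \<and> t < a else a < t \<and> t < b"
    and eq: "f b = f a + f' a * (b - a) + f'' t / 2 * (b - a)\<^sup>2"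
    by (auto simp: diff_def lessThan_nat_numeral lessThan_Suc)
  have "\<bar>t\<bar> \<le> K" using t ab by (auto split: if_splits)
  then have "\<bar>f'' t\<bar> / 2 * (b - a)\<^sup>2 \<le> M / 2 * (b - a)\<^sup>2"
    by (intro mult_right_mono divide_right_mono M) auto
  then show ?thesis
    unfolding eq by (simp add: abs_mult)
qed simp

text \<open>
  Clamping the argument of \<open>f\<close> to an interval \<open>[-K, K]\<close> with \<open>K \<ge> 1\<close> that contains the initial value makes
  the right-hand side globally Lipschitz and bounded.  The solution of the clamped equation never leaves
  the interval, by dissipativity, and so it solves the original equation.
\<close>

lemma reaction_solution_exists: "\<exists>w. reaction_solution f r w"
proof -
  define K where "K = max \<bar>r\<bar> 1"
  define c where "c = (\<lambda>x. max (- K) (min K x))"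
  have K: "K \<ge> 1" "\<bar>r\<bar> \<le> K" by (auto simp: K_def)
  have c: "\<bar>c x\<bar> \<le> K" "\<bar>c x - c y\<bar> \<le> \<bar>x - y\<bar>" for x y
    using K(1) by (auto simp: c_def max_def min_def)
  obtain L where L: "L > 0" "\<And>x. \<bar>x\<bar> \<le> K \<Longrightarrow> \<bar>f' x\<bar> \<le> L"
    using f'_bounded[of K] by blast
  have lip: "\<bar>f (c x) - f (c y)\<bar> \<le> L * \<bar>x - y\<bar>" for x y
  proof -
    have "\<bar>f (c x) - f (c y)\<bar> \<le> L * \<bar>c x - c y\<bar>"
      using f_lipschitz[of K L, OF L(2) c(1) c(1)] by simp
    also have "\<dots> \<le> L * \<bar>x - y\<bar>"
      using L(1) c(2) by (intro mult_left_mono) auto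
    finally show ?thesis .
  qed
  obtain B where B: "\<And>x. \<bar>x\<bar> \<le> K \<Longrightarrow> \<bar>f x\<bar> \<le> B"
    using f_bounded[of K] by blast
  have bound: "\<bar>f (c x)\<bar> \<le> B" for x
    by (rule B[OF c(1)])
  obtain w where w: "w 0 = r" "\<And>t. t \<ge> 0 \<Longrightarrow> (w has_real_derivative f (c (w t))) (at t within {0..})"
    using lipschitz_ode_solution_exists[of "\<lambda>x. f (c x)" L B r, OF lip L(1) bound] by blast
  have "c (w t) = w t" if "t \<ge> 0" for t
  proof -
    have "f K \<le> 0" "f (- K) \<ge> 0"
      using dissipative[of K] dissipative[of "- K"] K(1) by (auto simp: mult_le_0_iff zero_le_mult_iff)
    moreover have "c x = K" if "x > K" for x
      using that K(1) by (simp add: c_def)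
    moreover have "c x = - K" if "x < - K" for x
      using that K(1) by (simp add: c_def)
    ultimately have "\<bar>w t\<bar> \<le> K"
      using w K(2) that by (intro ode_invariant_interval[where g = "\<lambda>x. f (c x)" and w = w and t = t]) simp_all
    then show ?thesis by (auto simp: c_def)
  qed
  then have "reaction_solution f r w"
    using w unfolding reaction_solution_def by simp
  then show ?thesis by blast
qed

lemma reaction_solution_unique:
  assumes w: "reaction_solution f r w" and v: "reaction_solution f r v" and t: "t \<ge> 0"
  shows "w t = v t"
proof -
  have init: "w 0 = r" "v 0 = r"
    and dw: "\<And>s. s \<ge> 0 \<Longrightarrow> (w has_real_derivative f (w s)) (at s within {0..})"
    and dv: "\<And>s. s \<ge> 0 \<Longrightarrow> (v has_real_derivative f (v s)) (at s within {0..})"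
    using w v unfolding reaction_solution_def by blast+
  have "continuous_on {0..t} w" "continuous_on {0..t} v"
    by (rule continuous_on_ode_solution[where g = f], erule dw)
      (rule continuous_on_ode_solution[where g = f], erule dv)
  then have "bounded (w ` {0..t} \<union> v ` {0..t})"
    by (auto intro!: compact_imp_bounded compact_continuous_image)
  then obtain K where "\<forall>y\<in>w ` {0..t} \<union> v ` {0..t}. \<bar>y\<bar> \<le> K"
    by (auto simp: bounded_iff)
  then have K: "\<And>s. s \<in> {0..t} \<Longrightarrow> \<bar>w s\<bar> \<le> K" "\<And>s. s \<in> {0..t} \<Longrightarrow> \<bar>v s\<bar> \<le> K"
    by auto
  obtain L where L: "\<And>x. \<bar>x\<bar> \<le> K \<Longrightarrow> \<bar>f' x\<bar> \<le> L"
    using f'_bounded[of K] by blast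
  have "\<bar>w t - v t\<bar> \<le> exp (L * t) * \<bar>w 0 - v 0\<bar>"
  proof (rule ode_solutions_gronwall[where g = f and K = K and L = L and w = w and v = v and t = t])
    show "\<bar>f a - f b\<bar> \<le> L * \<bar>a - b\<bar>" if "\<bar>a\<bar> \<le> K" "\<bar>b\<bar> \<le> K" for a b
      by (rule f_lipschitz[OF L that])
  qed (fact dw dv K t)+
  then show ?thesis
    by (simp add: init)
qed

text \<open>
  The reaction flow acts pointwise, so it is determined by its action on constants; the evaluation
  point \<open>0\<close> is arbitrary.
\<close>

definition flow :: "real \<Rightarrow> real \<Rightarrow> real" where
  "flow t r = reaction_flow f t (\<lambda>_. r) 0"

lemma reaction_flow_eq_flow: "reaction_flow f t w0 x = flow t (w0 x)"
  unfolding flow_def reaction_flow_def ..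

lemma flow_eq:
  assumes "reaction_solution f r w" "t \<ge> 0"
  shows "flow t r = w t"
  unfolding flow_def reaction_flow_def
proof (rule the_equality)
  show "\<exists>v. reaction_solution f r v \<and> w t = v t"
    using assms(1) by (intro exI[of _ w]) simp
  fix y assume "\<exists>v. reaction_solution f r v \<and> y = v t"
  then obtain v where "reaction_solution f r v" "y = v t" by (elim exE conjE)
  then show "y = w t" using reaction_solution_unique[OF _ assms, of v] by simp
qed

lemma flow_0: "flow 0 r = r"
proof -
  obtain w where w: "reaction_solution f r w"
    using reaction_solution_exists[of r] ..
  then show ?thesis
    using flow_eq[OF w, of 0] unfolding reaction_solution_def by simp
qed

lemma flow_ode:
  assumes "t \<ge> 0"
  shows "((\<lambda>t. flow t r) has_real_derivative f (flow t r)) (at t within {0..})"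
proof -
  obtain w where w: "reaction_solution f r w"
    using reaction_solution_exists[of r] ..
  then have "(w has_real_derivative f (flow t r)) (at t within {0..})"
    using assms flow_eq[OF w] by (auto simp: reaction_solution_def)
  then show ?thesis
    by (rule has_field_derivative_transform_within[where d = 1]) (use assms flow_eq[OF w] in auto)
qed

lemma flow_derivative_time:
  "t > 0 \<Longrightarrow> ((\<lambda>t. flow t r) has_real_derivative f (flow t r)) (at t)"
  using flow_ode[of t r] by (simp add: at_within_atLeast_eq_at)

lemma flow_invariant_interval:
  assumes "\<bar>r\<bar> \<le> K" "K \<ge> 1" "t \<ge> 0"
  shows "\<bar>flow t r\<bar> \<le> K"
proof (rule ode_invariant_interval[where g = f and w = "\<lambda>t. flow t r"])
  fix x
  show "x > K \<Longrightarrow> f x \<le> 0"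
    using dissipative[of x] assms(2) by (auto simp: mult_le_0_iff)
  show "x < -K \<Longrightarrow> f x \<ge> 0"
    using dissipative[of x] assms(2) by (auto simp: mult_le_0_iff)
qed (use assms flow_ode flow_0 in auto)

lemma flow_lipschitz:
  assumes "\<bar>r\<bar> \<le> K" "\<bar>q\<bar> \<le> K" "K \<ge> 1" "t \<ge> 0" and L: "\<And>x. \<bar>x\<bar> \<le> K \<Longrightarrow> \<bar>f' x\<bar> \<le> L"
  shows "\<bar>flow t r - flow t q\<bar> \<le> exp (L * t) * \<bar>r - q\<bar>"
proof -
  have "\<bar>flow t r - flow t q\<bar> \<le> exp (L * t) * \<bar>flow 0 r - flow 0 q\<bar>"
  proof (rule ode_solutions_gronwall[where g = f and K = K and L = L and t = t
        and w = "\<lambda>t. flow t r" and v = "\<lambda>t. flow t q"])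
    show "\<bar>f a - f b\<bar> \<le> L * \<bar>a - b\<bar>" if "\<bar>a\<bar> \<le> K" "\<bar>b\<bar> \<le> K" for a b
      by (rule f_lipschitz[OF L that])
  qed (use assms in \<open>auto intro: flow_ode flow_invariant_interval\<close>)
  then show ?thesis by (simp add: flow_0)
qed

lemma continuous_flow_time: "continuous_on {0..} (\<lambda>t. flow t r)"
  by (rule DERIV_continuous_on[OF flow_ode]) auto

lemma continuous_flow: "continuous_on ({0..} \<times> UNIV) (\<lambda>(t, r). flow t r)"
proof (rule continuous_on_if_lipschitz_on_strips[OF continuous_flow_time])
  fix S K :: real
  assume K: "S \<ge> 0" "K \<ge> 1"
  obtain L where L: "L > 0" "\<And>x. \<bar>x\<bar> \<le> K \<Longrightarrow> \<bar>f' x\<bar> \<le> L"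
    using f'_bounded[of K] by blast
  have "\<bar>flow t r - flow t q\<bar> \<le> exp (L * S) * \<bar>r - q\<bar>"
    if "t \<in> {0..S}" "r \<in> {-K..K}" "q \<in> {-K..K}" for t r q
  proof -
    have "\<bar>flow t r - flow t q\<bar> \<le> exp (L * t) * \<bar>r - q\<bar>"
      using that K by (intro flow_lipschitz[of r K q t L] L(2)) auto
    also have "\<dots> \<le> exp (L * S) * \<bar>r - q\<bar>"
      using that L(1) by (intro mult_right_mono) auto
    finally show ?thesis .
  qed
  then show "\<exists>C. \<forall>t\<in>{0..S}. \<forall>r\<in>{-K..K}. \<forall>q\<in>{-K..K}. \<bar>flow t r - flow t q\<bar> \<le> C * \<bar>r - q\<bar>"
    by blast
qed

end

section \<open>Second-order dependence of the reaction flow on the initial value\<close>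

context dissipative_reaction
begin

text \<open>
  The solution \<open>\<phi>\<^sub>r\<close> of the linearised equation \<open>j' = f'(\<phi>) j\<close> with \<open>j = 1\<close> at time \<open>0\<close>.
\<close>

definition flow_jacobian :: "real \<Rightarrow> real \<Rightarrow> real" where
  "flow_jacobian t r = exp (integral {0..t} (\<lambda>s. f' (flow s r)))"

text \<open>
  The second derivative \<open>\<phi>\<^sub>r\<^sub>r\<close>, obtained by differentiating the exponential formula for \<open>\<phi>\<^sub>r\<close>.
\<close>

definition flow_hessian :: "real \<Rightarrow> real \<Rightarrow> real" where
  "flow_hessian t r = flow_jacobian t r * integral {0..t} (\<lambda>s. f'' (flow s r) * flow_jacobian s r)"

lemma continuous_f'_flow_time: "continuous_on {0..} (\<lambda>s. f' (flow s r))"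
  by (rule continuous_on_compose2[OF continuous_f'[of UNIV] continuous_flow_time]) auto

lemma flow_jacobian_0: "flow_jacobian 0 r = 1"
  by (simp add: flow_jacobian_def)

lemma flow_jacobian_pos: "flow_jacobian t r > 0"
  by (simp add: flow_jacobian_def)

lemma flow_jacobian_derivative_time:
  assumes "t \<ge> 0"
  shows "((\<lambda>t. flow_jacobian t r) has_real_derivative f' (flow t r) * flow_jacobian t r) (at t within {0..})"
proof -
  note [derivative_intros] = integral_has_real_derivative_atLeast[OF continuous_f'_flow_time assms]
  show ?thesis
    unfolding flow_jacobian_def by (auto intro!: derivative_eq_intros)
qed

lemma continuous_flow_jacobian_time: "continuous_on {0..} (\<lambda>t. flow_jacobian t r)"
  by (rule DERIV_continuous_on[OF flow_jacobian_derivative_time]) auto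

lemma flow_jacobian_bounds:
  assumes "\<bar>r\<bar> \<le> K" "K \<ge> 1" "t \<ge> 0" and L: "\<And>x. \<bar>x\<bar> \<le> K \<Longrightarrow> \<bar>f' x\<bar> \<le> L"
  shows "flow_jacobian t r \<le> exp (L * t)" and "1 / flow_jacobian t r \<le> exp (L * t)"
proof -
  have "norm (integral {0..t} (\<lambda>s. f' (flow s r))) \<le> L * (t - 0)"
  proof (rule integral_bound)
    show "continuous_on {0..t} (\<lambda>s. f' (flow s r))"
      by (rule continuous_on_subset[OF continuous_f'_flow_time]) auto
    show "norm (f' (flow s r)) \<le> L" if "s \<in> {0..t}" for s
      using L[OF flow_invariant_interval[OF assms(1,2), of s]] that by simp
  qed (use assms in auto)
  then have *: "integral {0..t} (\<lambda>s. f' (flow s r)) \<le> L * t"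
      "- integral {0..t} (\<lambda>s. f' (flow s r)) \<le> L * t"
    by auto
  show "flow_jacobian t r \<le> exp (L * t)"
    unfolding flow_jacobian_def using *(1) by simp
  have "1 / flow_jacobian t r = exp (- integral {0..t} (\<lambda>s. f' (flow s r)))"
    unfolding flow_jacobian_def by (simp add: exp_minus divide_inverse)
  also have "\<dots> \<le> exp (L * t)"
    using *(2) by simp
  finally show "1 / flow_jacobian t r \<le> exp (L * t)" .
qed

text \<open>
  The difference \<open>d\<close> of two solutions satisfies the linearised equation up to a Taylor remainder of
  second order in \<open>d\<close>, hence in \<open>h\<close>.  By variation of constants, the quotient of \<open>d\<close> by the Jacobian
  changes only by that remainder.
\<close>

lemma flow_expansion_initial:
  assumes "\<bar>r\<bar> \<le> K" "\<bar>r + h\<bar> \<le> K" "K \<ge> 1" "t > 0"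
    and L: "\<And>x. \<bar>x\<bar> \<le> K \<Longrightarrow> \<bar>f' x\<bar> \<le> L" and M: "\<And>x. \<bar>x\<bar> \<le> K \<Longrightarrow> \<bar>f'' x\<bar> \<le> M"
  shows "\<bar>flow t (r + h) - flow t r - h * flow_jacobian t r\<bar>
    \<le> exp (L * t) * (t * (M / 2 * (exp (L * t) * h)\<^sup>2 * exp (L * t)))"
proof -
  define d where "d = (\<lambda>s. flow s (r + h) - flow s r)"
  define P where "P = (\<lambda>s. d s / flow_jacobian s r)"
  define P' where "P' = (\<lambda>s. (f (flow s (r + h)) - f (flow s r) - f' (flow s r) * d s) / flow_jacobian s r)"
  have L0: "L \<ge> 0" and M0: "M \<ge> 0"
    using L[OF assms(1)] M[OF assms(1)] by linarith+
  have J_ne: "flow_jacobian s r \<noteq> 0" for s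
    using flow_jacobian_pos[of s r] by simp
  have deriv: "(P has_real_derivative P' s) (at s)" if "s > 0" for s
  proof -
    have "((\<lambda>t. flow_jacobian t r) has_real_derivative f' (flow s r) * flow_jacobian s r) (at s)"
      using flow_jacobian_derivative_time[of s r] that by (simp add: at_within_atLeast_eq_at)
    moreover have "(d has_real_derivative f (flow s (r + h)) - f (flow s r)) (at s)"
      unfolding d_def using that by (intro DERIV_diff flow_derivative_time)
    ultimately have "(P has_real_derivative ((f (flow s (r + h)) - f (flow s r)) * flow_jacobian s r
        - d s * (f' (flow s r) * flow_jacobian s r)) / (flow_jacobian s r * flow_jacobian s r)) (at s)"
      unfolding P_def using J_ne by (intro DERIV_divide)
    also have "((f (flow s (r + h)) - f (flow s r)) * flow_jacobian s r
        - d s * (f' (flow s r) * flow_jacobian s r)) / (flow_jacobian s r * flow_jacobian s r) = P' s"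
      unfolding P'_def using J_ne[of s] by (simp add: divide_simps) (simp add: algebra_simps)
    finally show ?thesis .
  qed
  have bound: "\<bar>P' s\<bar> \<le> M / 2 * (exp (L * t) * h)\<^sup>2 * exp (L * t)" if s: "0 < s" "s < t" for s
  proof -
    have exp_le: "exp (L * s) \<le> exp (L * t)"
      using s L0 by (simp add: mult_left_mono)
    have "\<bar>d s\<bar> \<le> exp (L * s) * \<bar>r + h - r\<bar>"
      unfolding d_def using s assms by (intro flow_lipschitz[of _ K]) auto
    also have "\<dots> \<le> exp (L * t) * \<bar>h\<bar>"
      using mult_right_mono[OF exp_le, of "\<bar>h\<bar>"] by simp
    also have "\<dots> = \<bar>exp (L * t) * h\<bar>"
      by (simp add: abs_mult)
    finally have "(d s)\<^sup>2 \<le> (exp (L * t) * h)\<^sup>2"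
      by (simp add: abs_le_square_iff)
    moreover have "\<bar>f (flow s (r + h)) - f (flow s r) - f' (flow s r) * d s\<bar> \<le> M / 2 * (d s)\<^sup>2"
      unfolding d_def using s assms by (intro taylor_remainder[of K] M flow_invariant_interval) auto
    ultimately have "\<bar>f (flow s (r + h)) - f (flow s r) - f' (flow s r) * d s\<bar> \<le> M / 2 * (exp (L * t) * h)\<^sup>2"
      using M0 by (meson divide_nonneg_nonneg mult_left_mono order_trans zero_le_numeral)
    moreover have "1 / flow_jacobian s r \<le> exp (L * t)"
      using flow_jacobian_bounds(2)[OF assms(1,3) _ L, of s] s exp_le by linarith
    ultimately have "\<bar>f (flow s (r + h)) - f (flow s r) - f' (flow s r) * d s\<bar> * (1 / flow_jacobian s r)
        \<le> M / 2 * (exp (L * t) * h)\<^sup>2 * exp (L * t)"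
      using M0 flow_jacobian_pos[of s r] by (intro mult_mono) auto
    then show ?thesis
      unfolding P'_def using flow_jacobian_pos[of s r] by simp
  qed
  have "continuous_on {0..t} P"
    unfolding P_def d_def using J_ne
    by (intro continuous_intros continuous_on_subset[OF continuous_flow_time]
        continuous_on_subset[OF continuous_flow_jacobian_time]) auto
  moreover have "P differentiable (at s)" if "0 < s" for s
    using deriv[OF that] real_differentiable_def by blast
  ultimately obtain l z where z: "0 < z" "z < t" "(P has_real_derivative l) (at z)" "P t - P 0 = (t - 0) * l"
    using MVT[OF \<open>t > 0\<close>, of P] by blast
  have "l = P' z"
    using DERIV_unique[OF z(3) deriv[OF z(1)]] .
  moreover have "P 0 = h"
    by (simp add: P_def d_def flow_0 flow_jacobian_0)
  ultimately have "P t - h = t * P' z"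
    using z(4) by simp
  then have "\<bar>P t - h\<bar> \<le> t * (M / 2 * (exp (L * t) * h)\<^sup>2 * exp (L * t))"
    using bound[OF z(1,2)] \<open>t > 0\<close> by (simp add: abs_mult)
  moreover have "flow t (r + h) - flow t r - h * flow_jacobian t r = flow_jacobian t r * (P t - h)"
    using J_ne[of t] by (simp add: P_def d_def field_simps)
  moreover have "flow_jacobian t r \<le> exp (L * t)"
    using flow_jacobian_bounds(1)[OF assms(1,3) _ L, of t] \<open>t > 0\<close> by simp
  ultimately show ?thesis
    using flow_jacobian_pos[of t r] by (simp only: abs_mult abs_of_pos) (intro mult_mono, auto)
qed

lemma flow_derivative_initial:
  assumes "t \<ge> 0"
  shows "(flow t has_real_derivative flow_jacobian t r) (at r)"
proof (cases "t = 0")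
  case True
  have "flow 0 = (\<lambda>x. x)" by (simp add: fun_eq_iff flow_0)
  then show ?thesis by (simp add: True flow_jacobian_0)
next
  case False
  define K where "K = \<bar>r\<bar> + 1"
  obtain L where L: "\<And>x. \<bar>x\<bar> \<le> K \<Longrightarrow> \<bar>f' x\<bar> \<le> L"
    using f'_bounded[of K] by blast
  obtain M where M: "\<And>x. \<bar>x\<bar> \<le> K \<Longrightarrow> \<bar>f'' x\<bar> \<le> M"
    using f''_bounded[of K] by blast
  define C where "C = exp (L * t) * (t * (M / 2 * (exp (L * t))\<^sup>2 * exp (L * t)))"
  have bound: "norm ((flow t (r + h) - flow t r) / h - flow_jacobian t r) \<le> C * \<bar>h\<bar>"
    if h: "h \<noteq> 0" "\<bar>h\<bar> < 1" for h
  proof -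
    have "\<bar>flow t (r + h) - flow t r - h * flow_jacobian t r\<bar>
        \<le> exp (L * t) * (t * (M / 2 * (exp (L * t) * h)\<^sup>2 * exp (L * t)))"
      using h False assms by (intro flow_expansion_initial[of r K] L M) (auto simp: K_def)
    also have "\<dots> = C * \<bar>h\<bar> * \<bar>h\<bar>"
      by (simp add: C_def power_mult_distrib mult_ac power2_eq_square)
    finally have "\<bar>flow t (r + h) - flow t r - h * flow_jacobian t r\<bar> / \<bar>h\<bar> \<le> C * \<bar>h\<bar>"
      using h by (simp add: pos_divide_le_eq)
    moreover have "(flow t (r + h) - flow t r) / h - flow_jacobian t r
        = (flow t (r + h) - flow t r - h * flow_jacobian t r) / h"
      using h(1) by (simp add: diff_divide_distrib)
    ultimately show ?thesis by simp
  qed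
  have "eventually (\<lambda>h::real. h \<noteq> 0 \<and> \<bar>h\<bar> < 1) (at 0)"
    unfolding eventually_at by (intro exI[of _ 1]) (auto simp: dist_real_def)
  then have "eventually (\<lambda>h. norm ((flow t (r + h) - flow t r) / h - flow_jacobian t r) \<le> C * \<bar>h\<bar>) (at 0)"
    by eventually_elim (use bound in auto)
  moreover have "((\<lambda>h::real. C * \<bar>h\<bar>) \<longlongrightarrow> 0) (at 0)"
    by (auto intro!: tendsto_eq_intros)
  ultimately have "((\<lambda>h. (flow t (r + h) - flow t r) / h - flow_jacobian t r) \<longlongrightarrow> 0) (at 0)"
    by (rule Lim_null_comparison)
  then show ?thesis
    unfolding DERIV_def by (rule LIM_zero_cancel)
qed

text \<open>
  Joint continuity is what differentiation under the integral sign requires in the next lemma.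
\<close>

lemma continuous_flow_jacobian: "continuous_on ({0..} \<times> UNIV) (\<lambda>(t, r). flow_jacobian t r)"
proof -
  define A where "A = (\<lambda>t r. integral {0..t} (\<lambda>s. f' (flow s r)))"
  have cont_f'_flow: "continuous_on {0..t} (\<lambda>s. f' (flow s r))" for t r
    by (rule continuous_on_subset[OF continuous_f'_flow_time]) auto
  have "continuous_on ({0..} \<times> UNIV) (\<lambda>(t, r). A t r)"
  proof (rule continuous_on_if_lipschitz_on_strips)
    show "continuous_on {0..} (\<lambda>t. A t r)" for r
      unfolding A_def
      by (rule DERIV_continuous_on[OF integral_has_real_derivative_atLeast[OF continuous_f'_flow_time]]) auto
    fix S K :: real
    assume K: "S \<ge> 0" "K \<ge> 1"
    obtain L where L: "L > 0" "\<And>x. \<bar>x\<bar> \<le> K \<Longrightarrow> \<bar>f' x\<bar> \<le> L"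
      using f'_bounded[of K] by blast
    obtain M where M: "M > 0" "\<And>x. \<bar>x\<bar> \<le> K \<Longrightarrow> \<bar>f'' x\<bar> \<le> M"
      using f''_bounded[of K] by blast
    have "\<bar>A t r - A t q\<bar> \<le> (M * exp (L * S) * S) * \<bar>r - q\<bar>"
      if t: "t \<in> {0..S}" and r: "r \<in> {-K..K}" and q: "q \<in> {-K..K}" for t r q
    proof -
      have rq: "\<bar>r\<bar> \<le> K" "\<bar>q\<bar> \<le> K" using r q by auto
      have "A t r - A t q = integral {0..t} (\<lambda>s. f' (flow s r) - f' (flow s q))"
        unfolding A_def by (rule integral_diff[symmetric]; intro integrable_continuous_interval cont_f'_flow)
      also have "norm \<dots> \<le> (M * (exp (L * S) * \<bar>r - q\<bar>)) * (t - 0)"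
      proof (rule integral_bound)
        show "continuous_on {0..t} (\<lambda>s. f' (flow s r) - f' (flow s q))"
          by (intro continuous_on_diff cont_f'_flow)
        fix s assume s: "s \<in> {0..t}"
        have "\<bar>f' (flow s r) - f' (flow s q)\<bar> \<le> M * \<bar>flow s r - flow s q\<bar>"
          using s rq K by (intro f'_lipschitz[of K] M(2) flow_invariant_interval) auto
        also have "\<bar>flow s r - flow s q\<bar> \<le> exp (L * s) * \<bar>r - q\<bar>"
          using s rq K by (intro flow_lipschitz[of r K q s L] L(2)) auto
        also have "exp (L * s) * \<bar>r - q\<bar> \<le> exp (L * S) * \<bar>r - q\<bar>"
          using s t L(1) by (intro mult_right_mono) auto
        finally show "norm (f' (flow s r) - f' (flow s q)) \<le> M * (exp (L * S) * \<bar>r - q\<bar>)"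
          using M(1) by simp
      qed (use t in auto)
      also have "\<dots> \<le> (M * (exp (L * S) * \<bar>r - q\<bar>)) * S"
        using t M(1) by (intro mult_left_mono) auto
      finally show ?thesis
        by (simp add: mult_ac)
    qed
    then show "\<exists>C. \<forall>t\<in>{0..S}. \<forall>r\<in>{-K..K}. \<forall>q\<in>{-K..K}. \<bar>A t r - A t q\<bar> \<le> C * \<bar>r - q\<bar>"
      by blast
  qed
  then have "continuous_on ({0..} \<times> UNIV) (\<lambda>x. exp (case x of (t, r) \<Rightarrow> A t r))"
    by (intro continuous_on_exp)
  then show ?thesis
    unfolding flow_jacobian_def A_def by (simp add: case_prod_unfold)
qed

lemma flow_jacobian_derivative_initial:
  assumes "t \<ge> 0"
  shows "(flow_jacobian t has_real_derivative flow_hessian t r) (at r)"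
proof -
  have cont_flow: "continuous_on (UNIV \<times> {0..t}) (\<lambda>x. flow (snd x) (fst x))"
    by (rule continuous_on_compose2[OF continuous_flow, where f = "\<lambda>x. (snd x, fst x)", simplified])
      (auto intro!: continuous_intros)
  have cont_jacobian: "continuous_on (UNIV \<times> {0..t}) (\<lambda>x. flow_jacobian (snd x) (fst x))"
    by (rule continuous_on_compose2[OF continuous_flow_jacobian, where f = "\<lambda>x. (snd x, fst x)", simplified])
      (auto intro!: continuous_intros)
  have "((\<lambda>r. integral (cbox 0 t) (\<lambda>s. f' (flow s r))) has_field_derivative
      integral (cbox 0 t) (\<lambda>s. f'' (flow s r) * flow_jacobian s r)) (at r within UNIV)"
  proof (rule leibniz_rule_field_derivative)
    show "((\<lambda>x. f' (flow s x)) has_real_derivative f'' (flow s x) * flow_jacobian s x) (at x within UNIV)"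
      if "s \<in> cbox 0 t" for x s
      using DERIV_chain2[OF f'' flow_derivative_initial[of s x]] that by simp
    show "(\<lambda>s. f' (flow s x)) integrable_on cbox 0 t" for x
      by (intro integrable_continuous continuous_on_subset[OF continuous_f'_flow_time]) auto
    show "continuous_on (UNIV \<times> cbox 0 t) (\<lambda>(x, s). f'' (flow s x) * flow_jacobian s x)"
      unfolding case_prod_unfold cbox_interval
      by (intro continuous_on_mult cont_jacobian continuous_on_compose2[OF continuous_f'' cont_flow]) auto
  qed auto
  then have A: "((\<lambda>r. integral {0..t} (\<lambda>s. f' (flow s r))) has_field_derivative
      integral {0..t} (\<lambda>s. f'' (flow s r) * flow_jacobian s r)) (at r)"
    by simp
  have "((\<lambda>r. exp (integral {0..t} (\<lambda>s. f' (flow s r)))) has_field_derivative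
      exp (integral {0..t} (\<lambda>s. f' (flow s r))) * integral {0..t} (\<lambda>s. f'' (flow s r) * flow_jacobian s r)) (at r)"
    by (rule DERIV_fun_exp[OF A])
  then show ?thesis
    by (simp add: flow_jacobian_def[abs_def] flow_hessian_def)
qed

lemma flow_hessian_bound:
  assumes "\<bar>r\<bar> \<le> K" "K \<ge> 1" "t \<ge> 0"
    and L: "\<And>x. \<bar>x\<bar> \<le> K \<Longrightarrow> \<bar>f' x\<bar> \<le> L" and M: "\<And>x. \<bar>x\<bar> \<le> K \<Longrightarrow> \<bar>f'' x\<bar> \<le> M"
  shows "\<bar>flow_hessian t r\<bar> \<le> t * exp (2 * t * L) * M"
proof -
  have L0: "L \<ge> 0" and M0: "M \<ge> 0"
    using L[OF assms(1)] M[OF assms(1)] by linarith+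
  have "norm (integral {0..t} (\<lambda>s. f'' (flow s r) * flow_jacobian s r)) \<le> (M * exp (L * t)) * (t - 0)"
  proof (rule integral_bound)
    show "continuous_on {0..t} (\<lambda>s. f'' (flow s r) * flow_jacobian s r)"
    proof (rule continuous_on_mult)
      show "continuous_on {0..t} (\<lambda>s. f'' (flow s r))"
        by (rule continuous_on_compose2[OF continuous_f'' continuous_on_subset[OF continuous_flow_time]]) auto
      show "continuous_on {0..t} (\<lambda>s. flow_jacobian s r)"
        by (rule continuous_on_subset[OF continuous_flow_jacobian_time]) auto
    qed
    fix s assume s: "s \<in> {0..t}"
    have "flow_jacobian s r \<le> exp (L * s)"
      using s assms(1,2) L by (intro flow_jacobian_bounds(1)[of r K]) auto
    also have "\<dots> \<le> exp (L * t)"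
      using s L0 by (simp add: mult_left_mono)
    finally have "\<bar>flow_jacobian s r\<bar> \<le> exp (L * t)"
      using flow_jacobian_pos[of s r] by simp
    moreover have "\<bar>f'' (flow s r)\<bar> \<le> M"
      using s assms(1,2) by (intro M flow_invariant_interval) auto
    ultimately show "norm (f'' (flow s r) * flow_jacobian s r) \<le> M * exp (L * t)"
      using M0 by (simp only: abs_mult real_norm_def) (intro mult_mono, auto)
  qed (use assms in auto)
  moreover have "\<bar>flow_jacobian t r\<bar> \<le> exp (L * t)"
    using flow_jacobian_bounds(1)[OF assms(1,2,3) L] flow_jacobian_pos[of t r] by simp
  ultimately have "\<bar>flow_hessian t r\<bar> \<le> exp (L * t) * ((M * exp (L * t)) * (t - 0))"
    unfolding flow_hessian_def abs_mult real_norm_def by (intro mult_mono) auto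
  also have "\<dots> = t * (exp (L * t) * exp (L * t)) * M"
    by (simp add: mult_ac)
  also have "exp (L * t) * exp (L * t) = exp (2 * t * L)"
    by (simp add: mult_exp_exp algebra_simps)
  finally show ?thesis .
qed

lemma flow_derivative_along_curve:
  assumes s: "s > 0" and v: "(v has_real_derivative v') (at s)"
  shows "((\<lambda>t. flow t (v t)) has_real_derivative f (flow s (v s)) + flow_jacobian s (v s) * v') (at s)"
proof -
  have "((\<lambda>(t, r). flow t r) has_derivative (\<lambda>(h, k). f (flow s (v s)) * h
      + blinfun_apply (blinfun_mult_right (flow_jacobian s (v s))) k)) (at (s, v s) within {0<..} \<times> UNIV)"
  proof (rule has_derivative_partialsI)
    show "((\<lambda>t. flow t (v s)) has_derivative (*) (f (flow s (v s)))) (at s within {0<..})"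
      using has_field_derivative_at_within[OF flow_derivative_time[OF s]]
      by (simp add: has_field_derivative_def)
    show "(flow t has_derivative blinfun_apply (blinfun_mult_right (flow_jacobian t r))) (at r within UNIV)"
      if "t \<in> {0<..}" for t r
      using flow_derivative_initial[of t r] that by (simp add: has_field_derivative_def)
    have "continuous_on ({0<..} \<times> UNIV) (\<lambda>(t, r). flow_jacobian t r)"
      by (rule continuous_on_subset[OF continuous_flow_jacobian]) auto
    then have "continuous_on ({0<..} \<times> UNIV) (\<lambda>x. blinfun_mult_right (case x of (t, r) \<Rightarrow> flow_jacobian t r))"
      by (rule bounded_linear.continuous_on[OF bounded_linear_blinfun_mult_right])
    then show "continuous (at (s, v s) within {0<..} \<times> UNIV) (\<lambda>(t, r). blinfun_mult_right (flow_jacobian t r))"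
      using s by (simp add: continuous_on_eq_continuous_within case_prod_unfold)
  qed auto
  moreover have "at (s, v s) within {0<..} \<times> UNIV = at (s, v s)"
    using s by (intro at_within_open open_Times) auto
  ultimately have flow: "((\<lambda>(t, r). flow t r) has_derivative
      (\<lambda>(h, k). f (flow s (v s)) * h + flow_jacobian s (v s) * k)) (at (s, v s))"
    by simp
  have "((\<lambda>t. (t, v t)) has_derivative (\<lambda>h. (h, v' * h))) (at s)"
    using v by (intro has_derivative_Pair has_derivative_ident) (simp add: has_field_derivative_def)
  from has_derivative_compose[OF this flow]
  have "((\<lambda>t. flow t (v t)) has_derivative (\<lambda>h. f (flow s (v s)) * h + flow_jacobian s (v s) * (v' * h))) (at s)"
    by simp
  moreover have "(\<lambda>h. f (flow s (v s)) * h + flow_jacobian s (v s) * (v' * h))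
      = (*) (f (flow s (v s)) + flow_jacobian s (v s) * v')"
    by (rule ext) (simp add: algebra_simps)
  ultimately show ?thesis
    by (simp add: has_field_derivative_def)
qed

end

section \<open>The heat semigroup as a Gaussian average\<close>

abbreviation std_gaussian :: "real measure" where
  "std_gaussian \<equiv> density lborel (\<lambda>z. ennreal (std_normal_density z))"

interpretation std_gaussian: prob_space std_gaussian
  by (rule prob_space_normal_density) simp

text \<open>
  After the substitution \<open>y = x + \<surd>(2t) z\<close> the time \<open>0\<close> is no longer singular, and the dependence on
  \<open>(t, x)\<close> sits in the argument of \<open>v\<close>.  Bounds, Lipschitz estimates and continuity up to \<open>t = 0\<close> become
  immediate in this form; derivatives for \<open>t > 0\<close> are instead taken on the kernel.
\<close>

lemma heat_flow_eq_expectation: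
  assumes t: "t \<ge> 0" and v [measurable]: "v \<in> borel_measurable borel"
  shows "heat_flow t v x = (\<integral>z. v (x + sqrt (2 * t) * z) \<partial>std_gaussian)"
proof (cases "t = 0")
  case True
  then show ?thesis
    using std_gaussian.prob_space by (simp add: heat_flow_def)
next
  case False
  define c where "c = sqrt (2 * t)"
  have c: "c > 0" "c\<^sup>2 = 2 * t"
    using False t by (simp_all add: c_def)
  have "heat_flow t v x = (LINT y|lborel. exp (- (x - y)\<^sup>2 / (4 * t)) / sqrt (4 * pi * t) * v y)"
    using False by (simp add: heat_flow_def)
  also have "\<dots> = \<bar>c\<bar> *\<^sub>R (LINT z|lborel. exp (- (x - (x + c * z))\<^sup>2 / (4 * t)) / sqrt (4 * pi * t) * v (x + c * z))"
    using c by (intro lborel_integral_real_affine) simp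
  also have "\<dots> = (LINT z|lborel. std_normal_density z *\<^sub>R v (x + c * z))"
    unfolding integral_scaleR_right[symmetric]
  proof (intro Bochner_Integration.integral_cong refl)
    fix z
    have "(c * z)\<^sup>2 / (4 * t) = z\<^sup>2 / 2"
      using False by (simp add: power_mult_distrib c)
    moreover have "sqrt (4 * pi * t) = c * sqrt (2 * pi)"
      unfolding c_def real_sqrt_mult[symmetric] by (rule arg_cong[of _ _ sqrt]) simp
    ultimately show "\<bar>c\<bar> *\<^sub>R (exp (- (x - (x + c * z))\<^sup>2 / (4 * t)) / sqrt (4 * pi * t) * v (x + c * z))
        = std_normal_density z *\<^sub>R v (x + c * z)"
      using c(1) by (simp add: std_normal_density_def)
  qed
  also have "\<dots> = (\<integral>z. v (x + c * z) \<partial>std_gaussian)"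
    by (intro integral_density[symmetric]) auto
  finally show ?thesis by (simp add: c_def)
qed

lemma integrable_std_gaussian_bounded:
  assumes "g \<in> borel_measurable borel" and "\<And>z. \<bar>g z\<bar> \<le> K"
  shows "integrable std_gaussian (g :: real \<Rightarrow> real)"
  by (rule std_gaussian.integrable_const_bound[of _ K]) (use assms in auto)

lemma measurable_affine:
  fixes v :: "real \<Rightarrow> real"
  assumes [measurable]: "v \<in> borel_measurable borel"
  shows "(\<lambda>z. v (x + c * z)) \<in> borel_measurable borel"
  by measurable

lemma abs_expectation_le:
  fixes g :: "real \<Rightarrow> real"
  assumes "g \<in> borel_measurable borel" and "\<And>z. \<bar>g z\<bar> \<le> K"
  shows "\<bar>\<integral>z. g z \<partial>std_gaussian\<bar> \<le> K"
proof -
  note int = integrable_std_gaussian_bounded[OF assms]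
  have "(\<integral>z. g z \<partial>std_gaussian) \<le> K"
    using assms(2) by (intro std_gaussian.integral_le_const int AE_I2) (auto simp: abs_le_iff)
  moreover have "- K \<le> (\<integral>z. g z \<partial>std_gaussian)"
  proof (intro std_gaussian.integral_ge_const int AE_I2)
    show "- K \<le> g z" for z using assms(2)[of z] by linarith
  qed
  ultimately show ?thesis by linarith
qed

lemma heat_flow_bound:
  assumes "t \<ge> 0" "v \<in> borel_measurable borel" "\<And>y. \<bar>v y\<bar> \<le> K"
  shows "\<bar>heat_flow t v x\<bar> \<le> K"
  unfolding heat_flow_eq_expectation[OF assms(1,2)]
  by (rule abs_expectation_le[OF measurable_affine[OF assms(2)] assms(3)])

lemma heat_flow_lipschitz:
  assumes t: "t \<ge> 0" and v: "v \<in> borel_measurable borel" "\<And>y. \<bar>v y\<bar> \<le> K"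
    and lip: "\<And>x y. \<bar>v x - v y\<bar> \<le> M * \<bar>x - y\<bar>"
  shows "\<bar>heat_flow t v x - heat_flow t v y\<bar> \<le> M * \<bar>x - y\<bar>"
proof -
  define c where "c = sqrt (2 * t)"
  have int: "integrable std_gaussian (\<lambda>z. v (x + c * z))" for x
    by (rule integrable_std_gaussian_bounded[OF measurable_affine[OF v(1)] v(2)])
  have "heat_flow t v x - heat_flow t v y = (\<integral>z. v (x + c * z) - v (y + c * z) \<partial>std_gaussian)"
    unfolding heat_flow_eq_expectation[OF t v(1)] c_def[symmetric]
    by (rule Bochner_Integration.integral_diff[symmetric]; rule int)
  also have "\<bar>\<dots>\<bar> \<le> M * \<bar>x - y\<bar>"
  proof (rule abs_expectation_le)
    show "(\<lambda>z. v (x + c * z) - v (y + c * z)) \<in> borel_measurable borel"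
      by (intro borel_measurable_diff measurable_affine v)
    show "\<bar>v (x + c * z) - v (y + c * z)\<bar> \<le> M * \<bar>x - y\<bar>" for z
      using lip[of "x + c * z" "y + c * z"] by simp
  qed
  finally show ?thesis .
qed

lemma borel_measurable_time_slice:
  fixes \<psi> :: "real \<Rightarrow> real \<Rightarrow> real"
  assumes cont: "continuous_on ({0..} \<times> UNIV) (\<lambda>(t, y). \<psi> t y)" and t: "t \<ge> 0"
  shows "\<psi> t \<in> borel_measurable borel"
proof (intro borel_measurable_continuous_onI)
  have "continuous_on UNIV (\<lambda>y. case (t, y) of (t, y) \<Rightarrow> \<psi> t y)"
    by (rule continuous_on_compose2[OF cont continuous_on_Pair[OF continuous_on_const continuous_on_id]])
      (use t in auto)
  then show "continuous_on UNIV (\<psi> t)" by simp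
qed

lemma continuous_on_heat_flow:
  fixes \<psi> :: "real \<Rightarrow> real \<Rightarrow> real"
  assumes cont: "continuous_on ({0..} \<times> UNIV) (\<lambda>(t, y). \<psi> t y)"
    and bound: "\<And>t y. t \<ge> 0 \<Longrightarrow> \<bar>\<psi> t y\<bar> \<le> K"
  shows "continuous_on ({0..} \<times> UNIV) (\<lambda>(t, x). heat_flow t (\<psi> t) x)"
  unfolding continuous_on_sequentially
proof (intro allI ballI impI, elim conjE)
  fix X :: "nat \<Rightarrow> real \<times> real" and a :: "real \<times> real"
  assume a: "a \<in> {0..} \<times> UNIV" and X: "\<forall>n. X n \<in> {0..} \<times> UNIV" and lim: "X \<longlonglongrightarrow> a"
  have a0: "fst a \<ge> 0" and X0: "fst (X n) \<ge> 0" for n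
    using a X by (auto simp: mem_Times_iff)
  note meas = borel_measurable_time_slice[OF cont]
  define s where "s = (\<lambda>p z. \<psi> (fst p) (snd p + sqrt (2 * fst p) * z))"
  have "(\<lambda>n. \<integral>z. s (X n) z \<partial>std_gaussian) \<longlonglongrightarrow> (\<integral>z. s a z \<partial>std_gaussian)"
  proof (rule integral_dominated_convergence[where w = "\<lambda>_. K"])
    show "AE z in std_gaussian. (\<lambda>n. s (X n) z) \<longlonglongrightarrow> s a z"
    proof (rule AE_I2)
      fix z
      define Y where "Y = (\<lambda>p. (fst p, snd p + sqrt (2 * fst p) * z))"
      have "(\<lambda>n. Y (X n)) \<longlonglongrightarrow> Y a"
        unfolding Y_def by (intro tendsto_intros lim)
      then have "((\<lambda>(t, y). \<psi> t y) \<circ> (\<lambda>n. Y (X n))) \<longlonglongrightarrow> (case Y a of (t, y) \<Rightarrow> \<psi> t y)"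
        using cont[unfolded continuous_on_sequentially, rule_format, of "Y a" "\<lambda>n. Y (X n)"] a0 X0
        by (simp add: Y_def)
      then show "(\<lambda>n. s (X n) z) \<longlonglongrightarrow> s a z"
        by (simp add: Y_def s_def o_def)
    qed
    show "s a \<in> borel_measurable std_gaussian"
      unfolding s_def using measurable_affine[OF meas[OF a0]] by simp
    show "s (X n) \<in> borel_measurable std_gaussian" for n
      unfolding s_def using measurable_affine[OF meas[OF X0]] by simp
    show "AE z in std_gaussian. norm (s (X n) z) \<le> K" for n
      using bound[OF X0] by (simp add: s_def)
  qed simp
  moreover have "(case p of (t, x) \<Rightarrow> heat_flow t (\<psi> t) x) = (\<integral>z. s p z \<partial>std_gaussian)" if "fst p \<ge> 0" for p
    unfolding s_def using heat_flow_eq_expectation[OF that meas[OF that]] by (simp add: case_prod_unfold)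
  ultimately show "((\<lambda>(t, x). heat_flow t (\<psi> t) x) \<circ> X) \<longlonglongrightarrow> (case a of (t, x) \<Rightarrow> heat_flow t (\<psi> t) x)"
    using a0 X0 by (simp add: o_def)
qed

lemma expectation_square_le_of_linear_growth:
  fixes g :: "real \<Rightarrow> real"
  assumes g [measurable]: "g \<in> borel_measurable borel" and growth: "\<And>z. \<bar>g z\<bar> \<le> c * \<bar>z\<bar>"
  shows "(\<integral>z. (g z)\<^sup>2 \<partial>std_gaussian) \<le> c\<^sup>2"
proof -
  have "(\<integral>z. (g z)\<^sup>2 \<partial>std_gaussian) \<le> (\<integral>z. c\<^sup>2 * z\<^sup>2 \<partial>std_gaussian)"
  proof (rule integral_mono_AE')
    have "integrable lborel (\<lambda>z. c\<^sup>2 * (std_normal_density z * z ^ 2))"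
      by (intro integrable_mult_right integrable_std_normal_moment)
    then show "integrable std_gaussian (\<lambda>z. c\<^sup>2 * z\<^sup>2)"
      by (subst integrable_density) (auto simp: mult_ac)
    have "(g z)\<^sup>2 \<le> c\<^sup>2 * z\<^sup>2" for z
    proof -
      have "\<bar>g z\<bar>\<^sup>2 \<le> (c * \<bar>z\<bar>)\<^sup>2"
        by (intro power_mono growth) auto
      then show ?thesis by (simp add: power_mult_distrib)
    qed
    then show "AE z in std_gaussian. (g z)\<^sup>2 \<le> c\<^sup>2 * z\<^sup>2" by simp
  qed simp
  also have "\<dots> = (LINT z|lborel. std_normal_density z *\<^sub>R (c\<^sup>2 * z\<^sup>2))"
    by (rule integral_density) auto
  also have "\<dots> = c\<^sup>2 * (LINT z|lborel. std_normal_density z * z ^ (2 * 1))"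
    unfolding integral_mult_right_zero[symmetric] by (rule Bochner_Integration.integral_cong) auto
  also have "\<dots> = c\<^sup>2"
    unfolding integral_std_normal_moment_even by simp
  finally show ?thesis .
qed

context dissipative_reaction
begin

text \<open>
  Expand \<open>f\<close> to second order at the mean of \<open>g\<close>: the linear term averages to zero.  The mean minimises
  \<open>a \<mapsto> E (g - a)\<^sup>2\<close>, so the second moment about any point \<open>a\<close> is an upper bound.
\<close>

lemma jensen_gap_le_variance:
  assumes g [measurable]: "g \<in> borel_measurable borel" and bound: "\<And>z. \<bar>g z\<bar> \<le> K"
    and M: "\<And>x. \<bar>x\<bar> \<le> K \<Longrightarrow> \<bar>f'' x\<bar> \<le> M"
  shows "\<bar>(\<integral>z. f (g z) \<partial>std_gaussian) - f (\<integral>z. g z \<partial>std_gaussian)\<bar>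
    \<le> M / 2 * (\<integral>z. (g z - a)\<^sup>2 \<partial>std_gaussian)"
proof -
  define m where "m = (\<integral>z. g z \<partial>std_gaussian)"
  have m: "\<bar>m\<bar> \<le> K"
    unfolding m_def by (rule abs_expectation_le[OF g bound])
  have M0: "M \<ge> 0" using M[OF m] by linarith
  have meas_f [measurable]: "f \<in> borel_measurable borel"
    by (intro borel_measurable_continuous_onI continuous_f)
  obtain B where B: "\<And>x. \<bar>x\<bar> \<le> K \<Longrightarrow> \<bar>f x\<bar> \<le> B"
    using f_bounded[of K] by blast
  have fg_bound: "\<bar>f (g z)\<bar> \<le> B" for z
    by (rule B[OF bound])
  have int_g: "integrable std_gaussian g"
    by (rule integrable_std_gaussian_bounded[OF g bound])
  have int_fg: "integrable std_gaussian (\<lambda>z. f (g z))"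
    by (rule integrable_std_gaussian_bounded[OF _ fg_bound]) simp
  have int_sq: "integrable std_gaussian (\<lambda>z. (g z - b)\<^sup>2)" for b
  proof (rule integrable_std_gaussian_bounded)
    have "\<bar>g z - b\<bar>\<^sup>2 \<le> (K + \<bar>b\<bar>)\<^sup>2" for z
      using bound[of z] by (intro power_mono) auto
    then show "\<bar>(g z - b)\<^sup>2\<bar> \<le> (K + \<bar>b\<bar>)\<^sup>2" for z by simp
  qed simp
  define R where "R = (\<lambda>z. f (g z) - f m - f' m * (g z - m))"
  have R: "\<bar>R z\<bar> \<le> M / 2 * (g z - m)\<^sup>2" for z
    unfolding R_def by (rule taylor_remainder[OF M m bound])
  have int_R: "integrable std_gaussian R"
    unfolding R_def by (intro Bochner_Integration.integrable_diff integrable_mult_right int_fg int_g) auto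
  have "(\<integral>z. R z \<partial>std_gaussian) = (\<integral>z. f (g z) \<partial>std_gaussian) - f m"
    unfolding R_def using int_fg int_g std_gaussian.prob_space by (simp add: m_def)
  then have "\<bar>(\<integral>z. f (g z) \<partial>std_gaussian) - f m\<bar> \<le> (\<integral>z. \<bar>R z\<bar> \<partial>std_gaussian)"
    using integral_norm_bound[of std_gaussian R] by simp
  also have "\<dots> \<le> (\<integral>z. M / 2 * (g z - m)\<^sup>2 \<partial>std_gaussian)"
    by (intro integral_mono R integrable_mult_right int_sq integrable_abs int_R)
  also have "\<dots> = M / 2 * (\<integral>z. (g z - m)\<^sup>2 \<partial>std_gaussian)"
    by simp
  also have "(\<integral>z. (g z - m)\<^sup>2 \<partial>std_gaussian) \<le> (\<integral>z. (g z - a)\<^sup>2 \<partial>std_gaussian)"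
  proof -
    have "(\<integral>z. (g z - a)\<^sup>2 \<partial>std_gaussian)
        = (\<integral>z. (g z - m)\<^sup>2 + (2 * (m - a) * (g z - m) + (m - a)\<^sup>2) \<partial>std_gaussian)"
      by (intro Bochner_Integration.integral_cong refl) (simp add: power2_eq_square algebra_simps)
    also have "\<dots> = (\<integral>z. (g z - m)\<^sup>2 \<partial>std_gaussian) + (m - a)\<^sup>2"
      using int_sq[of m] int_g std_gaussian.prob_space by (simp add: m_def)
    finally show ?thesis by simp
  qed
  finally show ?thesis
    using M0 by (simp add: m_def mult_left_mono)
qed

lemma heat_flow_reaction_commutator:
  assumes t: "t \<ge> 0" and g: "g \<in> borel_measurable borel" and bound: "\<And>y. \<bar>g y\<bar> \<le> K"
    and M: "\<And>x. \<bar>x\<bar> \<le> K \<Longrightarrow> \<bar>f'' x\<bar> \<le> M"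
    and lip: "M = 0 \<or> (\<forall>x y. \<bar>g x - g y\<bar> \<le> \<Lambda> * \<bar>x - y\<bar>)"
  shows "\<bar>heat_flow t (\<lambda>y. f (g y)) x - f (heat_flow t g x)\<bar> \<le> t * M * \<Lambda>\<^sup>2"
proof -
  define h where "h = (\<lambda>z. g (x + sqrt (2 * t) * z))"
  have h: "h \<in> borel_measurable borel"
    unfolding h_def by (rule measurable_affine[OF g])
  have "f \<in> borel_measurable borel"
    by (intro borel_measurable_continuous_onI continuous_f)
  then have fg: "(\<lambda>y. f (g y)) \<in> borel_measurable borel"
    using g by measurable
  have M0: "M \<ge> 0" using M[OF bound[of 0]] by linarith
  have "heat_flow t (\<lambda>y. f (g y)) x - f (heat_flow t g x)
      = (\<integral>z. f (h z) \<partial>std_gaussian) - f (\<integral>z. h z \<partial>std_gaussian)"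
    unfolding h_def heat_flow_eq_expectation[OF t g] heat_flow_eq_expectation[OF t fg] ..
  also have "\<bar>\<dots>\<bar> \<le> M / 2 * (\<integral>z. (h z - g x)\<^sup>2 \<partial>std_gaussian)"
    using bound by (intro jensen_gap_le_variance[of h K] h M) (auto simp: h_def)
  also have "\<dots> \<le> t * M * \<Lambda>\<^sup>2"
  proof (cases "M = 0")
    case False
    have "(\<integral>z. (h z - g x)\<^sup>2 \<partial>std_gaussian) \<le> (\<Lambda> * sqrt (2 * t))\<^sup>2"
    proof (rule expectation_square_le_of_linear_growth)
      show "(\<lambda>z. h z - g x) \<in> borel_measurable borel" using h by measurable
      show "\<bar>h z - g x\<bar> \<le> \<Lambda> * sqrt (2 * t) * \<bar>z\<bar>" for z
      proof -
        have "\<bar>h z - g x\<bar> \<le> \<Lambda> * \<bar>x + sqrt (2 * t) * z - x\<bar>"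
          unfolding h_def using lip False by blast
        then show ?thesis using t by (simp add: abs_mult mult_ac)
      qed
    qed
    also have "\<dots> = 2 * t * \<Lambda>\<^sup>2"
      using t by (simp add: power_mult_distrib)
    finally have "M / 2 * (\<integral>z. (h z - g x)\<^sup>2 \<partial>std_gaussian) \<le> M / 2 * (2 * t * \<Lambda>\<^sup>2)"
      using M0 by (intro mult_left_mono) auto
    then show ?thesis by (simp add: mult_ac)
  qed simp
  finally show ?thesis .
qed

end

section \<open>Differentiating the heat semigroup\<close>

text \<open>
  Differentiation under the integral sign: by the mean value theorem the integrable bound on the
  derivative also dominates the difference quotients.
\<close>

lemma has_real_derivative_integral_dominated:
  fixes F F' :: "real \<Rightarrow> 'a \<Rightarrow> real"
  assumes s0: "a < s0" "s0 < b"
    and deriv: "\<And>s y. a < s \<Longrightarrow> s < b \<Longrightarrow> ((\<lambda>s. F s y) has_real_derivative F' s y) (at s)"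
    and int: "\<And>s. a < s \<Longrightarrow> s < b \<Longrightarrow> integrable M (F s)"
    and meas: "F' s0 \<in> borel_measurable M"
    and dom: "\<And>s y. a < s \<Longrightarrow> s < b \<Longrightarrow> \<bar>F' s y\<bar> \<le> w y" and w: "integrable M w"
  shows "((\<lambda>s. \<integral>y. F s y \<partial>M) has_real_derivative (\<integral>y. F' s0 y \<partial>M)) (at s0)"
  unfolding has_field_derivative_iff tendsto_at_iff_sequentially
proof (intro allI impI)
  fix X :: "nat \<Rightarrow> real"
  assume X: "\<forall>i. X i \<in> UNIV - {s0}" and lim: "X \<longlonglongrightarrow> s0"
  have "eventually (\<lambda>n. X n \<in> {a<..<b}) sequentially"
    using lim s0 by (intro topological_tendstoD) auto
  then obtain N where N: "\<And>n. n \<ge> N \<Longrightarrow> a < X n \<and> X n < b"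
    by (auto simp: eventually_sequentially)
  define Y where "Y = (\<lambda>n. X (n + N))"
  have Y: "a < Y n" "Y n < b" "Y n \<noteq> s0" for n
    using N[of "n + N"] X by (auto simp: Y_def)
  have limY: "Y \<longlonglongrightarrow> s0"
    unfolding Y_def by (rule LIMSEQ_ignore_initial_segment[OF lim])
  have "(\<lambda>n. \<integral>y. (F (Y n) y - F s0 y) / (Y n - s0) \<partial>M) \<longlonglongrightarrow> (\<integral>y. F' s0 y \<partial>M)"
  proof (rule integral_dominated_convergence[where w = w])
    show "F' s0 \<in> borel_measurable M" by (rule meas)
    show "(\<lambda>y. (F (Y n) y - F s0 y) / (Y n - s0)) \<in> borel_measurable M" for n
      using int[OF Y(1,2)] int[OF s0] by (intro borel_measurable_divide borel_measurable_diff) auto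
    show "AE y in M. (\<lambda>n. (F (Y n) y - F s0 y) / (Y n - s0)) \<longlonglongrightarrow> F' s0 y"
    proof (rule AE_I2)
      fix y
      have "((\<lambda>s. (F s y - F s0 y) / (s - s0)) \<longlongrightarrow> F' s0 y) (at s0)"
        using deriv[OF s0] by (simp add: has_field_derivative_iff)
      then show "(\<lambda>n. (F (Y n) y - F s0 y) / (Y n - s0)) \<longlonglongrightarrow> F' s0 y"
        unfolding tendsto_at_iff_sequentially using Y(3) limY by (auto simp: o_def)
    qed
    show "AE y in M. norm ((F (Y n) y - F s0 y) / (Y n - s0)) \<le> w y" for n
    proof (rule AE_I2)
      fix y
      have "norm (F (Y n) y - F s0 y) \<le> w y * norm (Y n - s0)"
      proof (rule field_differentiable_bound[of "{a<..<b}" _ "\<lambda>s. F' s y"])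
        show "((\<lambda>s. F s y) has_real_derivative F' z y) (at z within {a<..<b})"
          if "z \<in> {a<..<b}" for z
          using that by (intro has_field_derivative_at_within[OF deriv]) auto
        show "norm (F' z y) \<le> w y" if "z \<in> {a<..<b}" for z
          using dom that by simp
      qed (use s0 Y in auto)
      then show "norm ((F (Y n) y - F s0 y) / (Y n - s0)) \<le> w y"
        using Y(3)[of n] by (simp add: pos_divide_le_eq)
    qed
  qed (rule w)
  moreover have "(\<integral>y. (F (Y n) y - F s0 y) / (Y n - s0) \<partial>M)
      = ((\<integral>y. F (Y n) y \<partial>M) - (\<integral>y. F s0 y \<partial>M)) / (Y n - s0)" for n
    using int[OF Y(1,2)] int[OF s0] by simp
  ultimately have "(\<lambda>n. ((\<integral>y. F (Y n) y \<partial>M) - (\<integral>y. F s0 y \<partial>M)) / (Y n - s0))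
      \<longlonglongrightarrow> (\<integral>y. F' s0 y \<partial>M)"
    by (simp only:)
  then have "(\<lambda>n. ((\<lambda>s. ((\<integral>y. F s y \<partial>M) - (\<integral>y. F s0 y \<partial>M)) / (s - s0)) \<circ> X) (n + N))
      \<longlonglongrightarrow> (\<integral>y. F' s0 y \<partial>M)"
    by (simp only: Y_def o_def)
  then show "((\<lambda>s. ((\<integral>y. F s y \<partial>M) - (\<integral>y. F s0 y \<partial>M)) / (s - s0)) \<circ> X)
      \<longlonglongrightarrow> (\<integral>y. F' s0 y \<partial>M)"
    by (rule LIMSEQ_offset)
qed

definition heat_kernel :: "real \<Rightarrow> real \<Rightarrow> real" where
  "heat_kernel t d = exp (- d\<^sup>2 / (4 * t)) / sqrt (4 * pi * t)"

definition heat_kernel_x :: "real \<Rightarrow> real \<Rightarrow> real" where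
  "heat_kernel_x t d = - (d / (2 * t)) * heat_kernel t d"

definition heat_kernel_xx :: "real \<Rightarrow> real \<Rightarrow> real" where
  "heat_kernel_xx t d = (d\<^sup>2 / (4 * t\<^sup>2) - 1 / (2 * t)) * heat_kernel t d"

lemma heat_kernel_deriv_x:
  assumes "t > 0"
  shows "(heat_kernel t has_real_derivative heat_kernel_x t d) (at d)"
  unfolding heat_kernel_def[abs_def] heat_kernel_x_def heat_kernel_def
  using assms by (auto intro!: derivative_eq_intros simp: field_simps)

lemma heat_kernel_x_deriv_x:
  assumes "t > 0"
  shows "(heat_kernel_x t has_real_derivative heat_kernel_xx t d) (at d)"
proof -
  have "((\<lambda>d. - (d / (2 * t)) * heat_kernel t d) has_real_derivative
      - (d / (2 * t)) * heat_kernel_x t d + - (1 / (2 * t)) * heat_kernel t d) (at d)"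
    by (rule DERIV_mult') (use assms in \<open>auto intro!: derivative_eq_intros heat_kernel_deriv_x\<close>)
  also have "- (d / (2 * t)) * heat_kernel_x t d + - (1 / (2 * t)) * heat_kernel t d = heat_kernel_xx t d"
    by (simp add: heat_kernel_x_def heat_kernel_xx_def algebra_simps power2_eq_square)
  finally show ?thesis
    by (simp add: heat_kernel_x_def[abs_def])
qed

lemma heat_kernel_deriv_t:
  assumes t: "t > 0"
  shows "((\<lambda>t. heat_kernel t d) has_real_derivative heat_kernel_xx t d) (at t)"
proof -
  define c where "c = 1 / sqrt (4 * pi)"
  have "((\<lambda>t. c * (exp (- d\<^sup>2 / (4 * t)) * (1 / sqrt t))) has_real_derivative
      c * (exp (- d\<^sup>2 / (4 * t)) * (- 1 / (2 * t * sqrt t)) + exp (- d\<^sup>2 / (4 * t)) * (d\<^sup>2 / (4 * t\<^sup>2)) * (1 / sqrt t))) (at t)"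
  proof (intro DERIV_cmult DERIV_mult')
    show "((\<lambda>t. exp (- d\<^sup>2 / (4 * t))) has_real_derivative exp (- d\<^sup>2 / (4 * t)) * (d\<^sup>2 / (4 * t\<^sup>2))) (at t)"
      using t by (auto intro!: derivative_eq_intros simp: power2_eq_square field_simps)
    show "((\<lambda>t. 1 / sqrt t) has_real_derivative - 1 / (2 * t * sqrt t)) (at t)"
      using t by (auto intro!: derivative_eq_intros simp: field_simps)
  qed
  also have "c * (exp (- d\<^sup>2 / (4 * t)) * (- 1 / (2 * t * sqrt t)) + exp (- d\<^sup>2 / (4 * t)) * (d\<^sup>2 / (4 * t\<^sup>2)) * (1 / sqrt t))
      = heat_kernel_xx t d"
    unfolding heat_kernel_xx_def heat_kernel_def c_def real_sqrt_mult[of "4 * pi" t]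
    using t by (simp add: field_simps)
  finally show ?thesis
    by (simp add: heat_kernel_def c_def real_sqrt_mult)
qed

lemma heat_kernel_measurable [measurable]:
  "(\<lambda>y. heat_kernel t (x - y)) \<in> borel_measurable borel"
  "(\<lambda>y. heat_kernel_x t (x - y)) \<in> borel_measurable borel"
  "(\<lambda>y. heat_kernel_xx t (x - y)) \<in> borel_measurable borel"
  unfolding heat_kernel_xx_def heat_kernel_x_def heat_kernel_def by measurable

text \<open>
  The time is kept in \<open>[a, b]\<close> with \<open>a > 0\<close>.  Half of the exponent \<open>d\<^sup>2 / (4 b)\<close> is spent on absorbing the
  polynomial prefactors, all of which are at most \<open>P + Q d\<^sup>2\<close>; the other half remains.
\<close>

lemma heat_kernel_gaussian_bound:
  assumes a: "a > 0" and t: "a \<le> t" "t \<le> b"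
  defines "P \<equiv> 1 + 1 / a" and "Q \<equiv> 1 / (2 * a) + 1 / (4 * a\<^sup>2)"
  defines "C \<equiv> 1 / sqrt (4 * pi * a) * (P + 8 * b * Q)"
  shows "\<bar>heat_kernel t d\<bar> \<le> C * exp (- d\<^sup>2 / (8 * b))"
    and "\<bar>heat_kernel_x t d\<bar> \<le> C * exp (- d\<^sup>2 / (8 * b))"
    and "\<bar>heat_kernel_xx t d\<bar> \<le> C * exp (- d\<^sup>2 / (8 * b))"
proof -
  have b: "b > 0" using a t by linarith
  have PQ: "P \<ge> 0" "Q \<ge> 0" using a by (auto simp: P_def Q_def)
  define q where "q = d\<^sup>2 / (8 * b)"
  have q: "q \<ge> 0" "d\<^sup>2 = 8 * b * q" using b by (auto simp: q_def)
  have "exp (- d\<^sup>2 / (4 * t)) \<le> exp (- d\<^sup>2 / (4 * b))"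
    using a t b by (simp add: frac_le)
  also have "- d\<^sup>2 / (4 * b) = - q - q"
    using b by (simp add: q_def field_simps)
  finally have "exp (- d\<^sup>2 / (4 * t)) \<le> exp (- q) * exp (- q)"
    by (simp add: mult_exp_exp)
  moreover have "1 / sqrt (4 * pi * t) \<le> 1 / sqrt (4 * pi * a)"
    using a t by (intro divide_left_mono) auto
  ultimately have "exp (- d\<^sup>2 / (4 * t)) * (1 / sqrt (4 * pi * t)) \<le> (exp (- q) * exp (- q)) * (1 / sqrt (4 * pi * a))"
    using a t by (intro mult_mono) auto
  then have kernel: "heat_kernel t d \<le> 1 / sqrt (4 * pi * a) * (exp (- q) * exp (- q))"
    by (simp add: heat_kernel_def mult.commute)
  have kernel_nonneg: "heat_kernel t d \<ge> 0"
    using a t by (simp add: heat_kernel_def)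
  have "q * exp (- q) \<le> 1"
  proof -
    have "q \<le> exp q" using exp_ge_add_one_self[of q] by linarith
    then show ?thesis by (simp add: exp_minus field_simps)
  qed
  have polynomial: "p * heat_kernel t d \<le> C * exp (- q)" if p: "0 \<le> p" "p \<le> P + Q * d\<^sup>2" for p
  proof -
    have "p * heat_kernel t d \<le> (P + Q * d\<^sup>2) * (1 / sqrt (4 * pi * a) * (exp (- q) * exp (- q)))"
      using p kernel kernel_nonneg by (intro mult_mono) auto
    also have "\<dots> = 1 / sqrt (4 * pi * a) * exp (- q) * (P * exp (- q) + 8 * b * Q * (q * exp (- q)))"
      by (simp add: q(2) algebra_simps add_divide_distrib)
    also have "\<dots> \<le> 1 / sqrt (4 * pi * a) * exp (- q) * (P * 1 + 8 * b * Q * 1)"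
      using a b q(1) PQ \<open>q * exp (- q) \<le> 1\<close> by (intro mult_left_mono add_mono mult_nonneg_nonneg) auto
    also have "\<dots> = C * exp (- q)"
      by (simp add: C_def mult_ac)
    finally show ?thesis .
  qed
  have exp_q: "exp (- d\<^sup>2 / (8 * b)) = exp (- q)" by (simp add: q_def)
  have d2: "\<bar>d\<bar> \<le> 1 + d\<^sup>2"
    using sum_squares_bound[of "\<bar>d\<bar>" 1] by simp
  have inv: "1 / (2 * t) \<le> 1 / (2 * a)"
    using a t by (intro divide_left_mono) auto
  have "a\<^sup>2 \<le> t\<^sup>2"
    using a t by (intro power_mono) auto
  then have inv2: "d\<^sup>2 / (4 * t\<^sup>2) \<le> d\<^sup>2 / (4 * a\<^sup>2)"
    using a t by (intro divide_left_mono) auto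
  have expand: "P + Q * d\<^sup>2 = 1 + 1 / a + d\<^sup>2 / (2 * a) + d\<^sup>2 / (4 * a\<^sup>2)"
    by (simp add: P_def Q_def algebra_simps)
  have nonneg: "1 / a \<ge> 0" "d\<^sup>2 / (2 * a) \<ge> 0" "d\<^sup>2 / (4 * a\<^sup>2) \<ge> 0" "d\<^sup>2 / (4 * t\<^sup>2) \<ge> 0" "1 / (2 * t) \<ge> 0"
    using a t by auto
  have half: "1 / (2 * a) \<le> 1 / a"
    using a by (intro divide_left_mono) auto
  show "\<bar>heat_kernel t d\<bar> \<le> C * exp (- d\<^sup>2 / (8 * b))"
    using polynomial[of 1] kernel_nonneg nonneg unfolding expand exp_q by simp
  have "\<bar>d\<bar> / (2 * t) \<le> (1 + d\<^sup>2) / (2 * a)"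
    using a t d2 by (intro frac_le) auto
  also have "\<dots> = 1 / (2 * a) + d\<^sup>2 / (2 * a)"
    by (simp add: add_divide_distrib)
  finally have "\<bar>d\<bar> / (2 * t) \<le> P + Q * d\<^sup>2"
    using half nonneg unfolding expand by linarith
  then show "\<bar>heat_kernel_x t d\<bar> \<le> C * exp (- d\<^sup>2 / (8 * b))"
    using polynomial[of "\<bar>d\<bar> / (2 * t)"] a t kernel_nonneg
    unfolding exp_q heat_kernel_x_def by (simp add: abs_mult)
  have "\<bar>d\<^sup>2 / (4 * t\<^sup>2) - 1 / (2 * t)\<bar> \<le> d\<^sup>2 / (4 * t\<^sup>2) + 1 / (2 * t)"
    using nonneg by linarith
  also have "\<dots> \<le> P + Q * d\<^sup>2"
    using inv inv2 half nonneg unfolding expand by linarith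
  finally show "\<bar>heat_kernel_xx t d\<bar> \<le> C * exp (- d\<^sup>2 / (8 * b))"
    using polynomial[of "\<bar>d\<^sup>2 / (4 * t\<^sup>2) - 1 / (2 * t)\<bar>"] kernel_nonneg
    unfolding exp_q heat_kernel_xx_def by (simp add: abs_mult)
qed

text \<open>
  One integrable function dominates the kernel and its derivatives for all times in \<open>[a, b]\<close> and all
  points within distance \<open>1\<close> of \<open>x0\<close>.  Moving the centre from \<open>x\<close> to \<open>x0\<close> costs half of the exponent and
  a constant factor.
\<close>

lemma heat_kernel_dominated:
  assumes a: "a > 0" "a \<le> b"
  obtains w where "integrable lborel w"
    and "\<And>t x y. a \<le> t \<Longrightarrow> t \<le> b \<Longrightarrow> \<bar>x - x0\<bar> \<le> 1 \<Longrightarrow> \<bar>heat_kernel t (x - y)\<bar> \<le> w y"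
    and "\<And>t x y. a \<le> t \<Longrightarrow> t \<le> b \<Longrightarrow> \<bar>x - x0\<bar> \<le> 1 \<Longrightarrow> \<bar>heat_kernel_x t (x - y)\<bar> \<le> w y"
    and "\<And>t x y. a \<le> t \<Longrightarrow> t \<le> b \<Longrightarrow> \<bar>x - x0\<bar> \<le> 1 \<Longrightarrow> \<bar>heat_kernel_xx t (x - y)\<bar> \<le> w y"
proof -
  define C where "C = 1 / sqrt (4 * pi * a) * (1 + 1 / a + 8 * b * (1 / (2 * a) + 1 / (4 * a\<^sup>2)))"
  have b: "b > 0" using a by linarith
  have C: "C \<ge> 0" using a b by (auto simp: C_def)
  define w where "w = (\<lambda>y. C * exp (1 / (8 * b)) * exp (- (y - x0)\<^sup>2 / (16 * b)))"
  have shift: "C * exp (- (x - y)\<^sup>2 / (8 * b)) \<le> w y" if "\<bar>x - x0\<bar> \<le> 1" for x y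
  proof -
    have "\<bar>x - x0\<bar>\<^sup>2 \<le> 1\<^sup>2"
      using that by (intro power_mono) auto
    then have "(x - x0)\<^sup>2 \<le> 1" by simp
    moreover have "(y - x0)\<^sup>2 \<le> 2 * (x - y)\<^sup>2 + 2 * (x - x0)\<^sup>2"
    proof -
      have "2 * (x - y)\<^sup>2 + 2 * (x - x0)\<^sup>2 - (y - x0)\<^sup>2 = ((x - y) + (x - x0))\<^sup>2"
        by (simp add: power2_eq_square algebra_simps)
      then show ?thesis by (metis diff_ge_0_iff_ge zero_le_power2)
    qed
    ultimately have "- (x - y)\<^sup>2 / (8 * b) \<le> (2 - (y - x0)\<^sup>2) / (16 * b)"
      using b by (simp add: field_simps)
    also have "\<dots> = 1 / (8 * b) + - (y - x0)\<^sup>2 / (16 * b)"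
      using b by (simp add: field_simps)
    finally have "exp (- (x - y)\<^sup>2 / (8 * b)) \<le> exp (1 / (8 * b)) * exp (- (y - x0)\<^sup>2 / (16 * b))"
      unfolding mult_exp_exp by simp
    then show ?thesis
      using C by (simp add: w_def mult.assoc mult_left_mono)
  qed
  have "integrable lborel (\<lambda>y. C * exp (1 / (8 * b)) * sqrt (2 * pi * (sqrt (8 * b))\<^sup>2) * normal_density x0 (sqrt (8 * b)) y)"
    by (intro integrable_mult_right integrable_normal_density) (use b in auto)
  also have "(\<lambda>y. C * exp (1 / (8 * b)) * sqrt (2 * pi * (sqrt (8 * b))\<^sup>2) * normal_density x0 (sqrt (8 * b)) y) = w"
    using b by (simp add: fun_eq_iff w_def normal_density_def)
  finally have "integrable lborel w" .
  note kernel = heat_kernel_gaussian_bound[OF a(1), of _ b, folded C_def]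
  show ?thesis
  proof (rule that[OF \<open>integrable lborel w\<close>])
    fix t x y
    assume t: "a \<le> t" "t \<le> b" and x: "\<bar>x - x0\<bar> \<le> 1"
    show "\<bar>heat_kernel t (x - y)\<bar> \<le> w y"
      by (rule order_trans[OF kernel(1)[OF t] shift[OF x]])
    show "\<bar>heat_kernel_x t (x - y)\<bar> \<le> w y"
      by (rule order_trans[OF kernel(2)[OF t] shift[OF x]])
    show "\<bar>heat_kernel_xx t (x - y)\<bar> \<le> w y"
      by (rule order_trans[OF kernel(3)[OF t] shift[OF x]])
  qed
qed

definition heat_flow_x :: "real \<Rightarrow> (real \<Rightarrow> real) \<Rightarrow> real \<Rightarrow> real" where
  "heat_flow_x t v x = (LINT y|lborel. heat_kernel_x t (x - y) * v y)"

definition heat_flow_xx :: "real \<Rightarrow> (real \<Rightarrow> real) \<Rightarrow> real \<Rightarrow> real" where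
  "heat_flow_xx t v x = (LINT y|lborel. heat_kernel_xx t (x - y) * v y)"

lemma heat_flow_eq_kernel:
  "t > 0 \<Longrightarrow> heat_flow t v x = (LINT y|lborel. heat_kernel t (x - y) * v y)"
  by (simp add: heat_flow_def heat_kernel_def)

lemma dominated_product:
  fixes k v w :: "real \<Rightarrow> real"
  assumes "integrable lborel w" and [measurable]: "k \<in> borel_measurable borel" "v \<in> borel_measurable borel"
    and k: "\<And>y. \<bar>k y\<bar> \<le> w y" and v: "\<And>y. \<bar>v y\<bar> \<le> K"
  shows "\<bar>k y * v y\<bar> \<le> w y * K" and "integrable lborel (\<lambda>y. k y * v y)"
proof -
  show le: "\<bar>k y * v y\<bar> \<le> w y * K" for y
    unfolding abs_mult by (intro mult_mono k v order_trans[OF abs_ge_zero k]) simp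
  show "integrable lborel (\<lambda>y. k y * v y)"
  proof (rule Bochner_Integration.integrable_bound)
    show "integrable lborel (\<lambda>y. w y * K)" using assms(1) by simp
    show "AE y in lborel. norm (k y * v y) \<le> norm (w y * K)"
      using le by (auto intro: order_trans[OF _ abs_ge_self])
  qed simp
qed

context
  fixes t :: real and v :: "real \<Rightarrow> real" and K :: real
  assumes t: "t > 0" and v: "v \<in> borel_measurable borel" and bound: "\<And>y. \<bar>v y\<bar> \<le> K"
begin

lemma heat_flow_deriv_x: "(heat_flow t v has_real_derivative heat_flow_x t v x) (at x)"
proof -
  obtain w where w: "integrable lborel w"
    and k: "\<And>z y. \<bar>z - x\<bar> \<le> 1 \<Longrightarrow> \<bar>heat_kernel t (z - y)\<bar> \<le> w y"
    and kx: "\<And>z y. \<bar>z - x\<bar> \<le> 1 \<Longrightarrow> \<bar>heat_kernel_x t (z - y)\<bar> \<le> w y"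
    using heat_kernel_dominated[OF t order_refl, of x] t by (metis order_refl)
  have "((\<lambda>z. LINT y|lborel. heat_kernel t (z - y) * v y) has_real_derivative heat_flow_x t v x) (at x)"
    unfolding heat_flow_x_def
  proof (rule has_real_derivative_integral_dominated[where a = "x - 1" and b = "x + 1" and w = "\<lambda>y. w y * K"])
    fix z y assume z: "x - 1 < z" "z < x + 1"
    then have z': "\<bar>z - x\<bar> \<le> 1" by auto
    have "((\<lambda>z. z - y) has_real_derivative 1) (at z)"
      by (auto intro!: derivative_eq_intros)
    from DERIV_chain2[OF heat_kernel_deriv_x[OF t] this]
    have "((\<lambda>z. heat_kernel t (z - y)) has_real_derivative heat_kernel_x t (z - y)) (at z)"
      by simp
    then show "((\<lambda>z. heat_kernel t (z - y) * v y) has_real_derivative heat_kernel_x t (z - y) * v y) (at z)"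
      by (rule DERIV_cmult_right)
    show "integrable lborel (\<lambda>y. heat_kernel t (z - y) * v y)"
      by (rule dominated_product(2)[OF w _ v k[OF z'] bound]) measurable
    show "\<bar>heat_kernel_x t (z - y) * v y\<bar> \<le> w y * K"
      by (rule dominated_product(1)[OF w _ v kx[OF z'] bound]) measurable
  qed (use v w in auto)
  moreover have "heat_flow t v = (\<lambda>z. LINT y|lborel. heat_kernel t (z - y) * v y)"
    by (simp add: fun_eq_iff heat_flow_eq_kernel[OF t])
  ultimately show ?thesis by simp
qed

lemma heat_flow_x_deriv_x: "(heat_flow_x t v has_real_derivative heat_flow_xx t v x) (at x)"
proof -
  obtain w where w: "integrable lborel w"
    and k: "\<And>z y. \<bar>z - x\<bar> \<le> 1 \<Longrightarrow> \<bar>heat_kernel_x t (z - y)\<bar> \<le> w y"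
    and kx: "\<And>z y. \<bar>z - x\<bar> \<le> 1 \<Longrightarrow> \<bar>heat_kernel_xx t (z - y)\<bar> \<le> w y"
    using heat_kernel_dominated[OF t order_refl, of x] t by (metis order_refl)
  show ?thesis
    unfolding heat_flow_x_def[abs_def] heat_flow_xx_def
  proof (rule has_real_derivative_integral_dominated[where a = "x - 1" and b = "x + 1" and w = "\<lambda>y. w y * K"])
    fix z y assume z: "x - 1 < z" "z < x + 1"
    then have z': "\<bar>z - x\<bar> \<le> 1" by auto
    have "((\<lambda>z. z - y) has_real_derivative 1) (at z)"
      by (auto intro!: derivative_eq_intros)
    from DERIV_chain2[OF heat_kernel_x_deriv_x[OF t] this]
    have "((\<lambda>z. heat_kernel_x t (z - y)) has_real_derivative heat_kernel_xx t (z - y)) (at z)"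
      by simp
    then show "((\<lambda>z. heat_kernel_x t (z - y) * v y) has_real_derivative heat_kernel_xx t (z - y) * v y) (at z)"
      by (rule DERIV_cmult_right)
    show "integrable lborel (\<lambda>y. heat_kernel_x t (z - y) * v y)"
      by (rule dominated_product(2)[OF w _ v k[OF z'] bound]) measurable
    show "\<bar>heat_kernel_xx t (z - y) * v y\<bar> \<le> w y * K"
      by (rule dominated_product(1)[OF w _ v kx[OF z'] bound]) measurable
  qed (use v w in auto)
qed

end

text \<open>
  The time derivative hits the kernel, where it gives \<open>\<partial>\<^sub>x\<^sub>x\<close> by the heat equation, and the datum.
  A datum that depends on time is needed for \<open>X\<^sup>t Y\<^sup>t u0\<close>.
\<close>

lemma heat_flow_deriv_t:
  fixes \<psi> \<psi>' :: "real \<Rightarrow> real \<Rightarrow> real"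
  assumes t: "t > 0"
    and meas: "\<And>s. s > 0 \<Longrightarrow> \<psi> s \<in> borel_measurable borel" "\<And>s. s > 0 \<Longrightarrow> \<psi>' s \<in> borel_measurable borel"
    and bound: "\<And>s y. s > 0 \<Longrightarrow> \<bar>\<psi> s y\<bar> \<le> K" "\<And>s y. s > 0 \<Longrightarrow> \<bar>\<psi>' s y\<bar> \<le> K'"
    and deriv: "\<And>s y. s > 0 \<Longrightarrow> ((\<lambda>s. \<psi> s y) has_real_derivative \<psi>' s y) (at s)"
  shows "((\<lambda>s. heat_flow s (\<psi> s) x) has_real_derivative
    heat_flow_xx t (\<psi> t) x + heat_flow t (\<psi>' t) x) (at t)"
proof -
  have ab: "t / 2 > 0" "t / 2 \<le> 2 * t" using t by auto
  obtain w where w: "integrable lborel w"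
    and k: "\<And>s y. t / 2 \<le> s \<Longrightarrow> s \<le> 2 * t \<Longrightarrow> \<bar>heat_kernel s (x - y)\<bar> \<le> w y"
    and kxx: "\<And>s y. t / 2 \<le> s \<Longrightarrow> s \<le> 2 * t \<Longrightarrow> \<bar>heat_kernel_xx s (x - y)\<bar> \<le> w y"
    using heat_kernel_dominated[OF ab, of x] by (metis abs_zero diff_self zero_le_one)
  have "((\<lambda>s. LINT y|lborel. heat_kernel s (x - y) * \<psi> s y) has_real_derivative
      (LINT y|lborel. heat_kernel_xx t (x - y) * \<psi> t y + heat_kernel t (x - y) * \<psi>' t y)) (at t)"
  proof (rule has_real_derivative_integral_dominated[where a = "t / 2" and b = "2 * t"
        and w = "\<lambda>y. w y * K + w y * K'"])
    fix s y assume s: "t / 2 < s" "s < 2 * t"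
    have s0: "s > 0" using s t by linarith
    note s' = less_imp_le[OF s(1)] less_imp_le[OF s(2)]
    show "((\<lambda>s. heat_kernel s (x - y) * \<psi> s y) has_real_derivative
        heat_kernel_xx s (x - y) * \<psi> s y + heat_kernel s (x - y) * \<psi>' s y) (at s)"
      using DERIV_mult'[OF heat_kernel_deriv_t[OF s0] deriv[OF s0]] by (simp add: add.commute)
    show "integrable lborel (\<lambda>y. heat_kernel s (x - y) * \<psi> s y)"
      by (rule dominated_product(2)[OF w _ meas(1)[OF s0] k[OF s'] bound(1)[OF s0]]) measurable
    have "\<bar>heat_kernel_xx s (x - y) * \<psi> s y\<bar> \<le> w y * K"
      by (rule dominated_product(1)[OF w _ meas(1)[OF s0] kxx[OF s'] bound(1)[OF s0]]) measurable
    moreover have "\<bar>heat_kernel s (x - y) * \<psi>' s y\<bar> \<le> w y * K'"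
      by (rule dominated_product(1)[OF w _ meas(2)[OF s0] k[OF s'] bound(2)[OF s0]]) measurable
    ultimately show "\<bar>heat_kernel_xx s (x - y) * \<psi> s y + heat_kernel s (x - y) * \<psi>' s y\<bar> \<le> w y * K + w y * K'"
      by linarith
  next
    show "(\<lambda>y. heat_kernel_xx t (x - y) * \<psi> t y + heat_kernel t (x - y) * \<psi>' t y) \<in> borel_measurable lborel"
      using meas[OF t] by measurable
  qed (use t w in auto)
  moreover have "(LINT y|lborel. heat_kernel_xx t (x - y) * \<psi> t y + heat_kernel t (x - y) * \<psi>' t y)
      = heat_flow_xx t (\<psi> t) x + heat_flow t (\<psi>' t) x"
    unfolding heat_flow_xx_def heat_flow_eq_kernel[OF t]
  proof (rule Bochner_Integration.integral_add)
    have t': "t / 2 \<le> t" "t \<le> 2 * t" using t by auto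
    show "integrable lborel (\<lambda>y. heat_kernel_xx t (x - y) * \<psi> t y)"
      by (rule dominated_product(2)[OF w _ meas(1)[OF t] kxx[OF t'] bound(1)[OF t]]) measurable
    show "integrable lborel (\<lambda>y. heat_kernel t (x - y) * \<psi>' t y)"
      by (rule dominated_product(2)[OF w _ meas(2)[OF t] k[OF t'] bound(2)[OF t]]) measurable
  qed
  ultimately have "((\<lambda>s. LINT y|lborel. heat_kernel s (x - y) * \<psi> s y) has_real_derivative
      heat_flow_xx t (\<psi> t) x + heat_flow t (\<psi>' t) x) (at t)"
    by simp
  then show ?thesis
    by (rule has_field_derivative_transform_within_open[where S = "{0<..}"])
      (use t in \<open>auto simp: heat_flow_eq_kernel\<close>)
qed

section \<open>The two splitting errors\<close>

lemma derivative_le_lipschitz_constant: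
  fixes g :: "real \<Rightarrow> real"
  assumes g: "(g has_real_derivative D) (at x)" and lip: "\<And>y. \<bar>g y - g x\<bar> \<le> M * \<bar>y - x\<bar>"
  shows "\<bar>D\<bar> \<le> M"
proof (rule tendsto_upperbound)
  show "((\<lambda>y. \<bar>(g y - g x) / (y - x)\<bar>) \<longlongrightarrow> \<bar>D\<bar>) (at x)"
    using g unfolding has_field_derivative_iff by (rule tendsto_rabs)
  show "eventually (\<lambda>y. \<bar>(g y - g x) / (y - x)\<bar> \<le> M) (at x)"
    using lip by (auto simp: eventually_at_filter pos_divide_le_eq)
qed simp

context dissipative_reaction
begin

context
  fixes u0 :: "real \<Rightarrow> real" and u :: "real \<Rightarrow> real \<Rightarrow> real" and \<kappa> L M D t :: real
  assumes sol: "reaction_diffusion_solution f u0 u"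
    and u0: "continuous_on UNIV u0" "\<And>x. \<bar>u0 x\<bar> \<le> \<kappa>" and \<kappa>: "\<kappa> \<ge> 1"
    and L: "\<And>x. \<bar>x\<bar> \<le> \<kappa> \<Longrightarrow> \<bar>f' x\<bar> \<le> L" and M: "\<And>x. \<bar>x\<bar> \<le> \<kappa> \<Longrightarrow> \<bar>f'' x\<bar> \<le> M"
    and lip: "M = 0 \<or> (\<forall>x y. \<bar>u0 x - u0 y\<bar> \<le> D * \<bar>x - y\<bar>)"
    and t: "t \<ge> 0"
begin

lemma bounds_nonneg: "L \<ge> 0" "M \<ge> 0"
  using L[OF u0(2)[of 0]] M[OF u0(2)[of 0]] by linarith+

lemma measurable_u0: "u0 \<in> borel_measurable borel"
  using u0(1) by (rule borel_measurable_continuous_onI)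

text \<open>
  The residual is the commutator of the heat flow with \<open>f\<close> at the datum \<open>\<psi> s = Y\<^sup>s u0\<close>, whose Lipschitz
  constant is \<open>e\<^bsup>Ls\<^esup> D\<close>.
\<close>

lemma splitting_error_heat_after_reaction:
  "\<bar>u t x - heat_flow t (reaction_flow f t u0) x\<bar> \<le> t\<^sup>2 * exp (2 * t * L) * (M * D\<^sup>2) / 2"
proof -
  define \<psi> where "\<psi> = (\<lambda>s y. flow s (u0 y))"
  have \<psi>_cont: "continuous_on ({0..} \<times> UNIV) (\<lambda>(s, y). \<psi> s y)"
    unfolding \<psi>_def case_prod_unfold
    by (rule continuous_on_compose2[OF continuous_flow, where f = "\<lambda>x. (fst x, u0 (snd x))", simplified])
      (auto intro!: continuous_intros continuous_on_compose2[OF u0(1)])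
  have \<psi>_bound: "\<bar>\<psi> s y\<bar> \<le> \<kappa>" if "s \<ge> 0" for s y
    unfolding \<psi>_def by (rule flow_invariant_interval[OF u0(2) \<kappa> that])
  have \<psi>_meas: "\<psi> s \<in> borel_measurable borel" if "s \<ge> 0" for s
    by (rule borel_measurable_time_slice[OF \<psi>_cont that])
  have f_meas: "f \<in> borel_measurable borel"
    by (intro borel_measurable_continuous_onI continuous_f)
  obtain B where B: "\<And>x. \<bar>x\<bar> \<le> \<kappa> \<Longrightarrow> \<bar>f x\<bar> \<le> B"
    using f_bounded[of \<kappa>] by blast
  have f_bound: "\<bar>f (\<psi> s y)\<bar> \<le> B" if "s \<ge> 0" for s y
    by (rule B[OF \<psi>_bound[OF that]])
  have "\<bar>u t x - heat_flow t (\<psi> t) x\<bar> \<le> t\<^sup>2 * exp (2 * t * L) * (M * D\<^sup>2) / 2"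
  proof (rule approximate_solution_error[where w = "\<lambda>s. heat_flow s (\<psi> s)" and \<kappa> = \<kappa>
        and w_t = "\<lambda>s x. heat_flow_xx s (\<psi> s) x + heat_flow s (\<lambda>y. f (\<psi> s y)) x"
        and w_x = "\<lambda>s. heat_flow_x s (\<psi> s)" and w_xx = "\<lambda>s. heat_flow_xx s (\<psi> s)", OF sol])
    show "\<bar>u s x\<bar> \<le> \<kappa>" if "s \<ge> 0" for s x
      by (rule reaction_diffusion_solution_invariant_interval[OF sol dissipative \<kappa> u0(2) that])
    show "\<bar>heat_flow s (\<psi> s) x\<bar> \<le> \<kappa>" if "s \<ge> 0" for s x
      by (rule heat_flow_bound[OF that \<psi>_meas[OF that] \<psi>_bound[OF that]])
    show "\<bar>f a - f b\<bar> \<le> L * \<bar>a - b\<bar>" if "\<bar>a\<bar> \<le> \<kappa>" "\<bar>b\<bar> \<le> \<kappa>" for a b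
      by (rule f_lipschitz[OF L that])
    show "heat_flow 0 (\<psi> 0) x = u0 x" for x
      by (simp add: heat_flow_def \<psi>_def flow_0)
    show "continuous_on ({0..} \<times> UNIV) (\<lambda>(s, x). heat_flow s (\<psi> s) x)"
      by (rule continuous_on_heat_flow[OF \<psi>_cont \<psi>_bound])
    fix s x :: real assume s: "s > 0"
    then have s0: "s \<ge> 0" by simp
    show "((\<lambda>s. heat_flow s (\<psi> s) x) has_real_derivative
        heat_flow_xx s (\<psi> s) x + heat_flow s (\<lambda>y. f (\<psi> s y)) x) (at s)"
    proof (rule heat_flow_deriv_t[OF s, where K = \<kappa> and K' = B])
      show "(\<lambda>y. f (\<psi> s y)) \<in> borel_measurable borel" if "s > 0" for s
        using measurable_compose[OF \<psi>_meas f_meas, of s] that by simp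
      show "((\<lambda>s. \<psi> s y) has_real_derivative f (\<psi> s y)) (at s)" if "s > 0" for s y
        unfolding \<psi>_def by (rule flow_derivative_time[OF that])
    qed (use \<psi>_meas \<psi>_bound f_bound in auto)
    show "(heat_flow s (\<psi> s) has_real_derivative heat_flow_x s (\<psi> s) x) (at x)"
      by (rule heat_flow_deriv_x[OF s \<psi>_meas[OF s0] \<psi>_bound[OF s0]])
    show "(heat_flow_x s (\<psi> s) has_real_derivative heat_flow_xx s (\<psi> s) x) (at x)"
      by (rule heat_flow_x_deriv_x[OF s \<psi>_meas[OF s0] \<psi>_bound[OF s0]])
    have "M = 0 \<or> (\<forall>x y. \<bar>\<psi> s x - \<psi> s y\<bar> \<le> exp (L * s) * D * \<bar>x - y\<bar>)"
    proof (cases "M = 0")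
      case False
      have "\<bar>\<psi> s x - \<psi> s y\<bar> \<le> exp (L * s) * D * \<bar>x - y\<bar>" for x y
      proof -
        have "\<bar>\<psi> s x - \<psi> s y\<bar> \<le> exp (L * s) * \<bar>u0 x - u0 y\<bar>"
          unfolding \<psi>_def by (rule flow_lipschitz[OF u0(2) u0(2) \<kappa> s0 L])
        also have "\<dots> \<le> exp (L * s) * (D * \<bar>x - y\<bar>)"
          using lip False by (intro mult_left_mono) auto
        finally show ?thesis by (simp add: mult.assoc)
      qed
      then show ?thesis by blast
    qed simp
    then have "\<bar>heat_flow s (\<lambda>y. f (\<psi> s y)) x - f (heat_flow s (\<psi> s) x)\<bar> \<le> s * M * (exp (L * s) * D)\<^sup>2"
      using heat_flow_reaction_commutator[OF s0 \<psi>_meas[OF s0] \<psi>_bound[OF s0] M] by blast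
    also have "\<dots> = s * exp (2 * s * L) * (M * D\<^sup>2)"
      by (simp add: power_mult_distrib exp_double[symmetric] mult_ac)
    finally show "\<bar>heat_flow_xx s (\<psi> s) x + heat_flow s (\<lambda>y. f (\<psi> s y)) x - heat_flow_xx s (\<psi> s) x
        - f (heat_flow s (\<psi> s) x)\<bar> \<le> s * exp (2 * s * L) * (M * D\<^sup>2)"
      by simp
  qed (use bounds_nonneg t in auto)
  moreover have "reaction_flow f t u0 = \<psi> t"
    by (simp add: fun_eq_iff \<psi>_def reaction_flow_eq_flow)
  ultimately show ?thesis by simp
qed

text \<open>
  Along \<open>w(s, x) = \<phi>(s, v(s, x))\<close> the terms with \<open>\<phi>\<^sub>r\<close> cancel by the heat equation for \<open>v\<close>, which
  leaves \<open>-\<phi>\<^sub>r\<^sub>r v\<^sub>x\<^sup>2\<close>.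
\<close>

lemma splitting_error_reaction_after_heat:
  "\<bar>u t x - reaction_flow f t (heat_flow t u0) x\<bar> \<le> t\<^sup>2 * exp (2 * t * L) * (M * D\<^sup>2) / 2"
proof -
  define v where "v = (\<lambda>s. heat_flow s u0)"
  have v_cont: "continuous_on ({0..} \<times> UNIV) (\<lambda>(s, y). v s y)"
    unfolding v_def
  proof (rule continuous_on_heat_flow[where \<psi> = "\<lambda>_. u0", OF _ u0(2)])
    show "continuous_on ({0..} \<times> UNIV) (\<lambda>(t::real, y). u0 y)"
      unfolding case_prod_unfold by (rule continuous_on_compose2[OF u0(1)]) (auto intro!: continuous_intros)
  qed
  have v_bound: "\<bar>v s y\<bar> \<le> \<kappa>" if "s \<ge> 0" for s y
    unfolding v_def by (rule heat_flow_bound[OF that measurable_u0 u0(2)])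
  have "\<bar>u t x - flow t (v t x)\<bar> \<le> t\<^sup>2 * exp (2 * t * L) * (M * D\<^sup>2) / 2"
  proof (rule approximate_solution_error[where w = "\<lambda>s x. flow s (v s x)" and \<kappa> = \<kappa>
        and w_t = "\<lambda>s x. f (flow s (v s x)) + flow_jacobian s (v s x) * heat_flow_xx s u0 x"
        and w_x = "\<lambda>s x. flow_jacobian s (v s x) * heat_flow_x s u0 x"
        and w_xx = "\<lambda>s x. flow_jacobian s (v s x) * heat_flow_xx s u0 x
          + flow_hessian s (v s x) * heat_flow_x s u0 x * heat_flow_x s u0 x", OF sol])
    show "\<bar>u s x\<bar> \<le> \<kappa>" if "s \<ge> 0" for s x
      by (rule reaction_diffusion_solution_invariant_interval[OF sol dissipative \<kappa> u0(2) that])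
    show "\<bar>flow s (v s x)\<bar> \<le> \<kappa>" if "s \<ge> 0" for s x
      by (rule flow_invariant_interval[OF v_bound[OF that] \<kappa> that])
    show "\<bar>f a - f b\<bar> \<le> L * \<bar>a - b\<bar>" if "\<bar>a\<bar> \<le> \<kappa>" "\<bar>b\<bar> \<le> \<kappa>" for a b
      by (rule f_lipschitz[OF L that])
    show "flow 0 (v 0 x) = u0 x" for x
      by (simp add: v_def heat_flow_def flow_0)
    show "continuous_on ({0..} \<times> UNIV) (\<lambda>(s, x). flow s (v s x))"
      unfolding case_prod_unfold
      by (rule continuous_on_compose2[OF continuous_flow, where f = "\<lambda>x. (fst x, v (fst x) (snd x))", simplified])
        (use v_cont in \<open>auto intro!: continuous_intros simp: case_prod_unfold\<close>)
    fix s x :: real assume s: "s > 0"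
    then have s0: "s \<ge> 0" by simp
    have "((\<lambda>s. v s x) has_real_derivative heat_flow_xx s u0 x + heat_flow s (\<lambda>_. 0) x) (at s)"
      unfolding v_def
      by (rule heat_flow_deriv_t[OF s, where \<psi> = "\<lambda>_. u0" and \<psi>' = "\<lambda>_ _. 0" and K = \<kappa> and K' = 0])
        (use measurable_u0 u0 in auto)
    then have v_t: "((\<lambda>s. v s x) has_real_derivative heat_flow_xx s u0 x) (at s)"
      by (simp add: heat_flow_eq_kernel[OF s])
    show "((\<lambda>s. flow s (v s x)) has_real_derivative
        f (flow s (v s x)) + flow_jacobian s (v s x) * heat_flow_xx s u0 x) (at s)"
      by (rule flow_derivative_along_curve[OF s v_t])
    have v_x: "(v s has_real_derivative heat_flow_x s u0 x) (at x)"
      unfolding v_def by (rule heat_flow_deriv_x[OF s measurable_u0 u0(2)])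
    show "((\<lambda>x. flow s (v s x)) has_real_derivative flow_jacobian s (v s x) * heat_flow_x s u0 x) (at x)"
      by (rule DERIV_chain2[OF flow_derivative_initial[OF s0] v_x])
    show "((\<lambda>x. flow_jacobian s (v s x) * heat_flow_x s u0 x) has_real_derivative
        flow_jacobian s (v s x) * heat_flow_xx s u0 x
          + flow_hessian s (v s x) * heat_flow_x s u0 x * heat_flow_x s u0 x) (at x)"
      by (rule DERIV_mult'[OF DERIV_chain2[OF flow_jacobian_derivative_initial[OF s0] v_x]
            heat_flow_x_deriv_x[OF s measurable_u0 u0(2)]])
    have "M * (heat_flow_x s u0 x)\<^sup>2 \<le> M * D\<^sup>2"
    proof (cases "M = 0")
      case False
      have "\<bar>heat_flow_x s u0 x\<bar> \<le> D"
        using lip False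
        by (intro derivative_le_lipschitz_constant[OF v_x]) (auto simp: v_def
            intro!: heat_flow_lipschitz[OF s0 measurable_u0 u0(2)])
      then have "\<bar>heat_flow_x s u0 x\<bar>\<^sup>2 \<le> D\<^sup>2"
        by (intro power_mono) auto
      then show ?thesis
        using bounds_nonneg by (simp add: mult_left_mono)
    qed simp
    then have "s * exp (2 * s * L) * (M * (heat_flow_x s u0 x)\<^sup>2) \<le> s * exp (2 * s * L) * (M * D\<^sup>2)"
      by (rule mult_left_mono) (use s in auto)
    moreover have "\<bar>flow_hessian s (v s x)\<bar> * (heat_flow_x s u0 x)\<^sup>2
        \<le> s * exp (2 * s * L) * M * (heat_flow_x s u0 x)\<^sup>2"
      by (intro mult_right_mono flow_hessian_bound[OF v_bound[OF s0] \<kappa> s0 L M]) auto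
    ultimately have "\<bar>flow_hessian s (v s x)\<bar> * (heat_flow_x s u0 x)\<^sup>2 \<le> s * exp (2 * s * L) * (M * D\<^sup>2)"
      by (simp add: mult.assoc)
    moreover have residual: "f (flow s (v s x)) + flow_jacobian s (v s x) * heat_flow_xx s u0 x
        - (flow_jacobian s (v s x) * heat_flow_xx s u0 x
          + flow_hessian s (v s x) * heat_flow_x s u0 x * heat_flow_x s u0 x) - f (flow s (v s x))
        = - (flow_hessian s (v s x) * (heat_flow_x s u0 x)\<^sup>2)"
      by (simp add: power2_eq_square)
    ultimately show "\<bar>f (flow s (v s x)) + flow_jacobian s (v s x) * heat_flow_xx s u0 x
        - (flow_jacobian s (v s x) * heat_flow_xx s u0 x
          + flow_hessian s (v s x) * heat_flow_x s u0 x * heat_flow_x s u0 x) - f (flow s (v s x))\<bar>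
        \<le> s * exp (2 * s * L) * (M * D\<^sup>2)"
      unfolding residual by (simp add: abs_mult)
  qed (use bounds_nonneg t in auto)
  then show ?thesis
    by (simp add: reaction_flow_eq_flow v_def)
qed

end

end

section \<open>The sup norm estimates\<close>

text \<open>
  If the derivative of \<open>u0\<close> is bounded, its supremum serves as the Lipschitz constant \<open>D\<close>.  Otherwise the
  right-hand side is infinite or its real factor is zero; the latter means \<open>t = 0\<close> or \<open>M = 0\<close>, and then
  \<open>g\<close> vanishes.
\<close>

lemma sup_norm_le_product:
  fixes g u0 :: "real \<Rightarrow> real" and t L M :: real
  assumes u0: "\<And>x. u0 differentiable (at x)" and "M \<ge> 0"
    and initial: "\<And>x. t = 0 \<Longrightarrow> g x = 0"
    and bound: "\<And>D x. M = 0 \<or> (\<forall>x y. \<bar>u0 x - u0 y\<bar> \<le> D * \<bar>x - y\<bar>) \<Longrightarrow>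
      \<bar>g x\<bar> \<le> t\<^sup>2 * exp (2 * t * L) * (M * D\<^sup>2) / 2"
  shows "sup_norm g \<le> ennreal (t\<^sup>2 * exp (2 * t * L) * M / 2) * (sup_norm (deriv u0))\<^sup>2"
proof -
  define c where "c = t\<^sup>2 * exp (2 * t * L) * M / 2"
  have c: "c \<ge> 0" using \<open>M \<ge> 0\<close> by (simp add: c_def)
  have "ennreal \<bar>g x\<bar> \<le> ennreal c * (sup_norm (deriv u0))\<^sup>2" for x
  proof (cases "sup_norm (deriv u0)")
    case (real D)
    have "ennreal \<bar>deriv u0 x\<bar> \<le> sup_norm (deriv u0)" for x
      unfolding sup_norm_def by (rule SUP_upper) simp
    then have D: "\<bar>deriv u0 x\<bar> \<le> D" for x
      using real by (simp add: ennreal_le_iff)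
    have "\<bar>u0 y - u0 z\<bar> \<le> D * \<bar>y - z\<bar>" for y z
    proof -
      have "norm (u0 y - u0 z) \<le> D * norm (y - z)"
        by (rule field_differentiable_bound[of UNIV _ "deriv u0"])
          (use u0 D in \<open>auto simp: DERIV_deriv_iff_real_differentiable\<close>)
      then show ?thesis by simp
    qed
    then have "\<bar>g x\<bar> \<le> t\<^sup>2 * exp (2 * t * L) * (M * D\<^sup>2) / 2"
      by (intro bound) blast
    then have "ennreal \<bar>g x\<bar> \<le> ennreal (c * D\<^sup>2)"
      by (intro ennreal_leI) (simp add: c_def mult_ac)
    also have "\<dots> = ennreal c * (ennreal D)\<^sup>2"
      using c real(1) by (simp add: ennreal_mult ennreal_power)
    finally show ?thesis using real by simp
  next
    case top
    show ?thesis
    proof (cases "c = 0")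
      case True
      then have "t = 0 \<or> M = 0" by (auto simp: c_def)
      then have "g x = 0"
        using initial[of x] bound[of 0 x] by auto
      then show ?thesis by simp
    next
      case False
      then show ?thesis
        using c top by (simp add: power2_eq_square ennreal_mult_top)
    qed
  qed
  then show ?thesis
    unfolding sup_norm_def[of g] c_def by (rule SUP_least)
qed

lemma abs_le_sup_norm_on:
  fixes g :: "real \<Rightarrow> real"
  assumes "continuous_on {-\<kappa>..\<kappa>} g" and "\<bar>x\<bar> \<le> \<kappa>"
  shows "\<bar>g x\<bar> \<le> sup_norm_on {-\<kappa>..\<kappa>} g"
  unfolding sup_norm_on_def
proof (rule cSUP_upper)
  show "x \<in> {-\<kappa>..\<kappa>}" using assms(2) by (simp add: abs_le_iff)
  have "compact ((\<lambda>x. \<bar>g x\<bar>) ` {-\<kappa>..\<kappa>})"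
    by (intro compact_continuous_image continuous_on_rabs assms(1) compact_Icc)
  then show "bdd_above ((\<lambda>x. \<bar>g x\<bar>) ` {-\<kappa>..\<kappa>})"
    by (intro bounded_imp_bdd_above compact_imp_bounded)
qed

lemma smooth_derivatives:
  assumes "smooth g"
  shows "(g has_real_derivative deriv g x) (at x)"
    and "(deriv g has_real_derivative deriv (deriv g) x) (at x)"
    and "(deriv (deriv g) has_real_derivative deriv (deriv (deriv g)) x) (at x)"
  using assms[unfolded smooth_def, rule_format, of 0 x] assms[unfolded smooth_def, rule_format, of 1 x]
    assms[unfolded smooth_def, rule_format, of 2 x]
  by (simp_all add: DERIV_deriv_iff_real_differentiable numeral_2_eq_2)

theorem theorem3:
  fixes f u0 :: "real \<Rightarrow> real" and u :: "real \<Rightarrow> real \<Rightarrow> real" and T t \<kappa> :: real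
  assumes "smooth f" and "f 0 = 0"
    and "\<And>r. \<bar>r\<bar> \<ge> 1 \<Longrightarrow> r * f r \<le> 0"
    and "T > 0" and "t \<in> {0..<T}"
    and "u0 \<in> Cb_infinity"
    and "reaction_diffusion_solution f u0 u"
    and "\<kappa> = max (sup_norm_on UNIV u0) 1"
  shows "sup_norm (\<lambda>x. u t x - heat_flow t (reaction_flow f t u0) x)
             \<le> ennreal (t\<^sup>2 * exp (2 * t * sup_norm_on {-\<kappa>..\<kappa>} (deriv f))
                 * sup_norm_on {-\<kappa>..\<kappa>} (deriv (deriv f)) / 2)
             * (sup_norm (deriv u0))\<^sup>2
         \<and> sup_norm (\<lambda>x. u t x - reaction_flow f t (heat_flow t u0) x)
             \<le> ennreal (t\<^sup>2 * exp (2 * t * sup_norm_on {-\<kappa>..\<kappa>} (deriv f))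
                 * sup_norm_on {-\<kappa>..\<kappa>} (deriv (deriv f)) / 2)
             * (sup_norm (deriv u0))\<^sup>2"
proof -
  define L where "L = sup_norm_on {-\<kappa>..\<kappa>} (deriv f)"
  define M where "M = sup_norm_on {-\<kappa>..\<kappa>} (deriv (deriv f))"
  note f_derivs = smooth_derivatives[OF \<open>smooth f\<close>]
  have continuous_f'': "continuous_on UNIV (deriv (deriv f))"
    using f_derivs(3) by (meson DERIV_isCont continuous_at_imp_continuous_on)
  interpret dissipative_reaction f "deriv f" "deriv (deriv f)"
    using f_derivs(1,2) continuous_f'' assms(3) by unfold_locales
  have L: "\<bar>deriv f x\<bar> \<le> L" if "\<bar>x\<bar> \<le> \<kappa>" for x
    unfolding L_def using continuous_f' that by (rule abs_le_sup_norm_on)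
  have M: "\<bar>deriv (deriv f) x\<bar> \<le> M" if "\<bar>x\<bar> \<le> \<kappa>" for x
    unfolding M_def using continuous_on_subset[OF continuous_f'' subset_UNIV] that
    by (rule abs_le_sup_norm_on)
  have u0: "smooth u0" "bounded (range u0)"
    using \<open>u0 \<in> Cb_infinity\<close> by (auto simp: Cb_infinity_def)
  have u0_deriv: "(u0 has_real_derivative deriv u0 x) (at x)" for x
    by (rule smooth_derivatives(1)[OF u0(1)])
  have u0_cont: "continuous_on UNIV u0"
    using u0_deriv by (meson DERIV_isCont continuous_at_imp_continuous_on)
  have \<kappa>: "\<kappa> \<ge> 1" using assms(8) by simp
  obtain B where "\<forall>y\<in>range u0. norm y \<le> B"
    using u0(2) unfolding bounded_iff by blast
  then have "bdd_above (range (\<lambda>x. \<bar>u0 x\<bar>))"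
    by (intro bdd_aboveI2[of _ _ B]) auto
  then have "\<bar>u0 x\<bar> \<le> sup_norm_on UNIV u0" for x
    unfolding sup_norm_on_def by (intro cSUP_upper) auto
  then have u0_bound: "\<bar>u0 x\<bar> \<le> \<kappa>" for x
    using assms(8) by (metis max.coboundedI1)
  have t: "t \<ge> 0" using assms(5) by simp
  have u_0: "u 0 = u0"
    using assms(7) by (simp add: reaction_diffusion_solution_def)
  have M0: "M \<ge> 0"
    using M[OF u0_bound[of 0]] by linarith
  have diff: "u0 differentiable (at x)" for x
    using u0_deriv real_differentiable_def by blast
  note split = assms(7) u0_cont u0_bound \<kappa> L M
  show ?thesis
    unfolding L_def[symmetric] M_def[symmetric]
  proof (intro conjI sup_norm_le_product diff M0)
    show "u t x - heat_flow t (reaction_flow f t u0) x = 0" if "t = 0" for x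
      by (simp add: that u_0 heat_flow_def reaction_flow_eq_flow flow_0)
    show "u t x - reaction_flow f t (heat_flow t u0) x = 0" if "t = 0" for x
      by (simp add: that u_0 heat_flow_def reaction_flow_eq_flow flow_0)
    fix D x
    assume lip: "M = 0 \<or> (\<forall>x y. \<bar>u0 x - u0 y\<bar> \<le> D * \<bar>x - y\<bar>)"
    show "\<bar>u t x - heat_flow t (reaction_flow f t u0) x\<bar> \<le> t\<^sup>2 * exp (2 * t * L) * (M * D\<^sup>2) / 2"
      by (rule splitting_error_heat_after_reaction[OF split lip t])
    show "\<bar>u t x - reaction_flow f t (heat_flow t u0) x\<bar> \<le> t\<^sup>2 * exp (2 * t * L) * (M * D\<^sup>2) / 2"
      by (rule splitting_error_reaction_after_heat[OF split lip t])
  qed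
qed

end
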